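(* Let $F$ and $G$ be experiments on the (action) state space $\Theta=\{\theta_0,\ldots,\theta_n\}$. The following are equivalent: (i) $F\succeq_{\textup{LB}}G$; (ii) $F$ is more flexible than $G$: for every $\boldsymbol{\delta}^*\in\widehat{\Delta}_n$ and every moral hazard environment $\mathcal{M}$, if $\boldsymbol{\delta}^*$ is implementable under $G$ in $\mathcal{M}$ then it is implementable under $F$ in $\mathcal{M}$; (iii) $F$ is more effective than $G$: $I_F(\boldsymbol{\delta}^*,\mathcal{M})\le I_G(\boldsymbol{\delta}^*,\mathcal{M})$ for every $\boldsymbol{\delta}^*\in\widehat{\Delta}_n$ and every moral hazard environment $\mathcal{M}$.
   Context: $\Theta=\{\theta_0,\ldots,\theta_n\}\subset\mathbb{R}$ is the set of the agent's pure actions. An experiment $F$ specifies, for each $\theta$, an absolutely continuous distribution $F(\cdot\mid\theta)$ with density $f(\cdot\mid\theta)$ of a signal in a compact interval $\mathcal{X}$; likewise $G$ on a compact interval $\mathcal{Y}$ with densities $g(\cdot\mid\theta)$. $\widehat{\Delta}_n=\{\boldsymbol{\delta}\in[0,1]^n:\sum_i\delta_i\le1\}$; $\boldsymbol{\delta}$ is a mixed action putting probability $\delta_i$ on $\theta_i$ ($i\ge1$) and $\delta_0=1-\sum_i\delta_i$ on $\theta_0$, and induces signal distribution $F(\cdot\mid\boldsymbol{\delta})=\sum_{i=0}^n\delta_iF(\cdot\mid\theta_i)$. LB order: with $p_{F,i}(x;\boldsymbol{q})=q_if(x\mid\theta_i)/\sum_jq_jf(x\mid\theta_j)$ and $\boldsymbol{p}_F(\boldsymbol{q})=(p_{F,1},\ldots,p_{F,n})(X;\boldsymbol{q})$,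 $X\sim F(\cdot\mid\boldsymbol{q})$, $F\succeq_{\textup{LB}}G$ means $\mathbb{E}[C(\boldsymbol{b}\cdot\boldsymbol{p}_F(\boldsymbol{q}))]\ge\mathbb{E}[C(\boldsymbol{b}\cdot\boldsymbol{p}_G(\boldsymbol{q}))]$ for all $\boldsymbol{q}\in\widehat{\Delta}_n$, $\boldsymbol{b}\in\mathbb{R}^n$ and convex $C:\mathbb{R}\to\mathbb{R}$. A moral hazard environment is $\mathcal{M}=\{\boldsymbol{u},c,\gamma\}$ with $\boldsymbol{u}=(\underline{u},\overline{u})\in\mathbb{R}^2$, $\underline{u}\le\overline{u}$; $c:\widehat{\Delta}_n\to\mathbb{R}$ convex (agent's cost); $\gamma:[\underline{u},\overline{u}]\to\mathbb{R}$ continuous and convex (principal's disutility of delivering utility to the agent). Let $\mathcal{W}^{\boldsymbol{u}}_F$ be the set of Borel-measurable $\hat{w}:\mathcal{X}\to[\underline{u},\overline{u}]$. Define $I_F(\boldsymbol{\delta}^*,\mathcal{M})=\inf_{\hat{w}\in\mathcal{W}^{\boldsymbol{u}}_F}\int_{\mathcal{X}}\gamma(\hat{w}(x))\,dF(x\mid\boldsymbol{\delta}^* )$ subject to (IR) $\int_{\mathcal{X}}\hat{w}\,dF(\cdot\mid\boldsymbol{\delta}^* )-c(\boldsymbol{\delta}^* )\ge0$ and (IC) $\boldsymbol{\delta}^*\in\arg\max_{\boldsymbol{\delta}\in\widehat{\Delta}_n}\big[\int_{\mathcal{X}}\hat{w}\,dF(\cdot\mid\boldsymbol{\delta})-c(\boldsymbol{\delta})\big]$.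 The action $\boldsymbol{\delta}^*$ is implementable under $F$ (in $\mathcal{M}$) if some $\hat{w}\in\mathcal{W}^{\boldsymbol{u}}_F$ satisfies (IR) and (IC); $I_F(\boldsymbol{\delta}^*,\mathcal{M})=+\infty$ if not. Everything is defined analogously for $G$. *)

theory Defs
  imports "HOL-Analysis.Analysis"
begin

text \<open>Actions theta_0..theta_n are identified with indices 0..n.
  A mixed action in hat-Delta_n is represented by a function nat => real whose
  coordinates 1..n are delta_1..delta_n and which vanishes at 0 and above n;
  the weight on theta_0 is delta_0 = 1 - sum of delta_i.\<close>

definition hatDelta :: "nat \<Rightarrow> (nat \<Rightarrow> real) set" where
  "hatDelta n = {d. (\<forall>i. 1 \<le> i \<and> i \<le> n \<longrightarrow> 0 \<le> d i \<and> d i \<le> 1)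
                  \<and> (\<forall>i. (i = 0 \<or> n < i) \<longrightarrow> d i = 0)
                  \<and> (\<Sum>i=1..n. d i) \<le> 1}"

definition wt :: "nat \<Rightarrow> (nat \<Rightarrow> real) \<Rightarrow> nat \<Rightarrow> real" where
  "wt n d i = (if i = 0 then 1 - (\<Sum>j=1..n. d j) else d i)"

definition mixdens :: "nat \<Rightarrow> (nat \<Rightarrow> real \<Rightarrow> real) \<Rightarrow> (nat \<Rightarrow> real) \<Rightarrow> real \<Rightarrow> real" where
  "mixdens n f d x = (\<Sum>i=0..n. wt n d i * f i x)"

definition is_experiment :: "nat \<Rightarrow> real \<Rightarrow> real \<Rightarrow> (nat \<Rightarrow> real \<Rightarrow> real) \<Rightarrow> bool" where
  "is_experiment n a b f \<longleftrightarrow> a \<le> b \<and>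
     (\<forall>i\<le>n. f i \<in> borel_measurable borel \<and> (\<forall>x\<in>{a..b}. 0 \<le> f i x)
            \<and> set_integrable lborel {a..b} (f i)
            \<and> (LINT x:{a..b}|lborel. f i x) = 1)"

definition post :: "nat \<Rightarrow> (nat \<Rightarrow> real \<Rightarrow> real) \<Rightarrow> (nat \<Rightarrow> real) \<Rightarrow> nat \<Rightarrow> real \<Rightarrow> real" where
  "post n f q i x = wt n q i * f i x / mixdens n f q x"

definition LB_ge ::
  "nat \<Rightarrow> real \<Rightarrow> real \<Rightarrow> (nat \<Rightarrow> real \<Rightarrow> real) \<Rightarrow> real \<Rightarrow> real \<Rightarrow> (nat \<Rightarrow> real \<Rightarrow> real) \<Rightarrow> bool" where
  "LB_ge n a b f a' b' g \<longleftrightarrow>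
     (\<forall>q\<in>hatDelta n. \<forall>bb :: nat \<Rightarrow> real. \<forall>C :: real \<Rightarrow> real. convex_on UNIV C \<longrightarrow>
        (LINT x:{a..b}|lborel. C (\<Sum>i=1..n. bb i * post n f q i x) * mixdens n f q x)
        \<ge> (LINT y:{a'..b'}|lborel. C (\<Sum>i=1..n. bb i * post n g q i y) * mixdens n g q y))"

text \<open>Convexity of the cost c on hat-Delta_n (convex_on written out, since nat => real
  carries no vector-space instance).\<close>
definition cost_convex :: "nat \<Rightarrow> ((nat \<Rightarrow> real) \<Rightarrow> real) \<Rightarrow> bool" where
  "cost_convex n c \<longleftrightarrow> (\<forall>d\<in>hatDelta n. \<forall>d'\<in>hatDelta n. \<forall>t::real. 0 \<le> t \<and> t \<le> 1 \<longrightarrow>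
       c (\<lambda>i. t * d i + (1 - t) * d' i) \<le> t * c d + (1 - t) * c d')"

definition mh_env :: "nat \<Rightarrow> real \<Rightarrow> real \<Rightarrow> ((nat \<Rightarrow> real) \<Rightarrow> real) \<Rightarrow> (real \<Rightarrow> real) \<Rightarrow> bool" where
  "mh_env n ulo uhi c \<gamma> \<longleftrightarrow> ulo \<le> uhi \<and> cost_convex n c
      \<and> continuous_on {ulo..uhi} \<gamma> \<and> convex_on {ulo..uhi} \<gamma>"

definition wages :: "real \<Rightarrow> real \<Rightarrow> real \<Rightarrow> real \<Rightarrow> (real \<Rightarrow> real) set" where
  "wages a b ulo uhi = {w. set_borel_measurable borel {a..b} w \<and> (\<forall>x\<in>{a..b}. ulo \<le> w x \<and> w x \<le> uhi)}"

definition pay :: "nat \<Rightarrow> real \<Rightarrow> real \<Rightarrow> (nat \<Rightarrow> real \<Rightarrow> real) \<Rightarrow> (real \<Rightarrow> real) \<Rightarrow> (nat \<Rightarrow> real) \<Rightarrow> real" where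
  "pay n a b f w d = (LINT x:{a..b}|lborel. w x * mixdens n f d x)"

definition feasible ::
  "nat \<Rightarrow> real \<Rightarrow> real \<Rightarrow> (nat \<Rightarrow> real \<Rightarrow> real) \<Rightarrow> real \<Rightarrow> real \<Rightarrow> ((nat \<Rightarrow> real) \<Rightarrow> real)
     \<Rightarrow> (nat \<Rightarrow> real) \<Rightarrow> (real \<Rightarrow> real) set" where
  "feasible n a b f ulo uhi c ds = {w \<in> wages a b ulo uhi.
       pay n a b f w ds - c ds \<ge> 0
     \<and> (\<forall>d\<in>hatDelta n. pay n a b f w d - c d \<le> pay n a b f w ds - c ds)}"

definition implementable ::
  "nat \<Rightarrow> real \<Rightarrow> real \<Rightarrow> (nat \<Rightarrow> real \<Rightarrow> real) \<Rightarrow> real \<Rightarrow> real \<Rightarrow> ((nat \<Rightarrow> real) \<Rightarrow> real)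
     \<Rightarrow> (nat \<Rightarrow> real) \<Rightarrow> bool" where
  "implementable n a b f ulo uhi c ds \<longleftrightarrow> feasible n a b f ulo uhi c ds \<noteq> {}"

text \<open>Implementation cost I_F(ds, M), valued in the extended reals (Inf of the empty set is +infinity).\<close>
definition impl_cost ::
  "nat \<Rightarrow> real \<Rightarrow> real \<Rightarrow> (nat \<Rightarrow> real \<Rightarrow> real) \<Rightarrow> real \<Rightarrow> real \<Rightarrow> ((nat \<Rightarrow> real) \<Rightarrow> real)
     \<Rightarrow> (real \<Rightarrow> real) \<Rightarrow> (nat \<Rightarrow> real) \<Rightarrow> ereal" where
  "impl_cost n a b f ulo uhi c \<gamma> ds =
     (INF w \<in> feasible n a b f ulo uhi c ds. ereal (LINT x:{a..b}|lborel. \<gamma> (w x) * mixdens n f ds x))"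

definition more_flexible ::
  "nat \<Rightarrow> real \<Rightarrow> real \<Rightarrow> (nat \<Rightarrow> real \<Rightarrow> real) \<Rightarrow> real \<Rightarrow> real \<Rightarrow> (nat \<Rightarrow> real \<Rightarrow> real) \<Rightarrow> bool" where
  "more_flexible n a b f a' b' g \<longleftrightarrow>
     (\<forall>ds\<in>hatDelta n. \<forall>ulo uhi c \<gamma>. mh_env n ulo uhi c \<gamma> \<longrightarrow>
        implementable n a' b' g ulo uhi c ds \<longrightarrow> implementable n a b f ulo uhi c ds)"

definition more_effective ::
  "nat \<Rightarrow> real \<Rightarrow> real \<Rightarrow> (nat \<Rightarrow> real \<Rightarrow> real) \<Rightarrow> real \<Rightarrow> real \<Rightarrow> (nat \<Rightarrow> real \<Rightarrow> real) \<Rightarrow> bool" where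
  "more_effective n a b f a' b' g \<longleftrightarrow>
     (\<forall>ds\<in>hatDelta n. \<forall>ulo uhi c \<gamma>. mh_env n ulo uhi c \<gamma> \<longrightarrow>
        impl_cost n a b f ulo uhi c \<gamma> ds \<le> impl_cost n a' b' g ulo uhi c \<gamma> ds)"

end

theory Submission
  imports Defs
begin

text \<open>All three orders are equivalent to the inclusion of zonoids, that is, to
  \<open>\<integral> (\<Sum>i. v\<^sub>i g\<^sub>i)\<^sup>+ \<le> \<integral> (\<Sum>i. v\<^sub>i f\<^sub>i)\<^sup>+\<close> for all vectors \<open>v\<close> (below: \<open>excess\<close>). It is the linear
  Blackwell order for hinge functions under the uniform prior, and convex functions on an interval are
  uniform limits of positive combinations of hinges plus affine functions.
  Given a contract under \<open>g\<close>, a contract under \<open>f\<close> with the same payoffs from all pure actions and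
  no larger cost exists by duality: the Lagrangian of the cost minimisation is maximised pointwise, and its
  value is a sum of hinges in the densities. Conversely, flexibility in environments where the cost of
  effort equals the payoff of a zero-one contract under \<open>g\<close> yields the inclusion.\<close>

section \<open>Convex functions on a grid\<close>

text \<open>A contract enters (IR) and (IC) only through its payoffs from the n + 1 pure actions.
  The cost of effort is arbitrary, so these payoffs must be reproduced exactly: a small error could
  already break (IC). Hence the dual bound, which holds only up to a small error, has to be combined
  with an optimum that is attained. Densities may vanish, so hinges are kept in the homogeneous form
  \<open>max 0 (s - k * m)\<close>, where \<open>s\<close> and \<open>m\<close> are combinations of
  densities, instead of being applied to a ratio. In the converse, flexibility fixes the moments
  only up to a common constant, the rent left to the agent. It does no harm in directions
  \<open>v\<close> whose coordinates have a nonnegative sum. The other directions reduce to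
  \<open>- v\<close>, because a positive part minus the positive part of the negative is the
  function itself, whose integral is the same under both experiments.\<close>

lemma grid_cell:
  fixes lo h t :: real
  assumes "lo \<le> t" "t \<le> lo + real N * h" "0 < N"
  obtains j where "j < N" "lo + real j * h \<le> t" "t \<le> lo + real (Suc j) * h"
proof -
  have "\<exists>j<N. lo + real j * h \<le> t \<and> t \<le> lo + real (Suc j) * h"
    using assms(2,3)
  proof (induction N)
    case (Suc N)
    show ?case
    proof (cases "lo + real N * h \<le> t")
      case True
      then show ?thesis using Suc.prems by blast
    next
      case False
      then have "0 < N" using assms(1) by (cases N) auto
      then obtain j where "j < N" "lo + real j * h \<le> t" "t \<le> lo + real (Suc j) * h"
        using Suc.IH False by auto
      then show ?thesis using less_SucI by blast
    qed
  qed simp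
  then show ?thesis using that by blast
qed

lemma initial_segment:
  fixes L :: nat
  assumes "\<And>i j. i \<le> j \<Longrightarrow> j < L \<Longrightarrow> P j \<Longrightarrow> P i"
  shows "\<exists>k\<le>L. {j. j < L \<and> P j} = {..<k}"
  using assms
proof (induction L)
  case (Suc L)
  show ?case
  proof (cases "P L")
    case True
    then have "{j. j < Suc L \<and> P j} = {..<Suc L}" using Suc.prems[of _ L] by auto
    then show ?thesis by blast
  next
    case False
    then have "{j. j < Suc L \<and> P j} = {j. j < L \<and> P j}" by (auto simp: less_Suc_eq)
    moreover obtain k where "k \<le> L" "{j. j < L \<and> P j} = {..<k}"
      using Suc.IH Suc.prems less_SucI by blast
    ultimately show ?thesis using le_SucI by blast
  qed
qed auto

text \<open>Slopes are given by increments and not by quotients, so that the degenerate interval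
  \<open>lo = hi\<close>, with \<open>h = 0\<close>, is covered.\<close>

locale chord_grid =
  fixes lo hi :: real and \<phi> :: "real \<Rightarrow> real" and \<epsilon> :: real and N :: nat and h :: real and \<sigma> :: "nat \<Rightarrow> real"
  assumes N_pos: "0 < N" and h_nonneg: "0 \<le> h" and hi_eq: "lo + real N * h = hi"
    and slope_mono: "i \<le> j \<Longrightarrow> j < N \<Longrightarrow> \<sigma> i \<le> \<sigma> j"
    and slope: "j < N \<Longrightarrow> \<phi> (lo + real (Suc j) * h) = \<phi> (lo + real j * h) + h * \<sigma> j"
    and osc: "x \<in> {lo..hi} \<Longrightarrow> y \<in> {lo..hi} \<Longrightarrow> \<bar>x - y\<bar> \<le> h \<Longrightarrow> \<bar>\<phi> x - \<phi> y\<bar> \<le> \<epsilon>"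
begin

definition node :: "nat \<Rightarrow> real" where "node j = lo + real j * h"

lemma node_mono: "i \<le> j \<Longrightarrow> node i \<le> node j"
  using h_nonneg by (auto simp: node_def intro: mult_right_mono)

lemma node_in: "j \<le> N \<Longrightarrow> node j \<in> {lo..hi}"
  using node_mono[of 0 j] node_mono[of j N] hi_eq by (auto simp: node_def)

lemma node_Suc: "node (Suc j) = node j + h"
  by (simp add: node_def algebra_simps)

lemma value_node_Suc: "j < N \<Longrightarrow> \<phi> (node (Suc j)) = \<phi> (node j) + h * \<sigma> j"
  using slope by (simp add: node_def)

lemma value_node: "j \<le> N \<Longrightarrow> \<phi> (node j) = \<phi> lo + (\<Sum>l<j. h * \<sigma> l)"
  by (induction j) (auto simp: value_node_Suc, simp add: node_def)

lemma cell:
  assumes "t \<in> {lo..hi}"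
  obtains j where "j < N" "node j \<le> t" "t \<le> node (Suc j)"
    "\<bar>\<phi> t - \<phi> (node j)\<bar> \<le> \<epsilon>" "\<bar>\<phi> t - \<phi> (node (Suc j))\<bar> \<le> \<epsilon>"
proof -
  obtain j where j: "j < N" "node j \<le> t" "t \<le> node (Suc j)"
    using grid_cell[of lo t N h] assms N_pos hi_eq unfolding node_def by auto
  then show ?thesis
    using that[OF j] osc[OF assms node_in, of j] osc[OF assms node_in, of "Suc j"] node_Suc[of j] by auto
qed

text \<open>The approximant is the piecewise linear interpolant at the nodes. The weight of a kink
  is the jump of the slope there, nonnegative by convexity.\<close>

lemma hinge_approx:
  obtains K :: nat and \<alpha> \<beta> :: real and c k :: "nat \<Rightarrow> real"
  where "\<And>l. l < K \<Longrightarrow> 0 \<le> c l"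
    "\<And>t. t \<in> {lo..hi} \<Longrightarrow> \<bar>\<phi> t - (\<alpha> + \<beta> * t + (\<Sum>l<K. c l * max 0 (t - k l)))\<bar> \<le> \<epsilon>"
proof -
  define c where "c l = \<sigma> (Suc l) - \<sigma> l" for l
  have telescope: "\<phi> lo + \<sigma> 0 * (t - lo) + (\<Sum>l<j. c l * (t - node (Suc l))) = \<phi> (node j) + \<sigma> j * (t - node j)"
    if "j < N" for j t
    using that
  proof (induction j)
    case 0
    then show ?case by (simp add: node_def)
  next
    case (Suc j)
    then have "\<phi> lo + \<sigma> 0 * (t - lo) + (\<Sum>l<Suc j. c l * (t - node (Suc l)))
      = \<phi> (node j) + \<sigma> j * (t - node j) + c j * (t - node (Suc j))" by simp
    also have "\<dots> = \<phi> (node (Suc j)) + \<sigma> (Suc j) * (t - node (Suc j))"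
      using slope[of j] Suc.prems by (simp add: node_def c_def algebra_simps)
    finally show ?case .
  qed
  show ?thesis
  \<comment> \<open>Only interior nodes carry a kink: hence \<open>N - 1\<close> hinges and the
    shift to \<open>Suc l\<close>.\<close>
  proof (rule that[of "N - 1" c "\<phi> lo - \<sigma> 0 * lo" "\<sigma> 0" "\<lambda>l. node (Suc l)"])
    fix l assume "l < N - 1"
    then show "0 \<le> c l" using slope_mono[of l "Suc l"] by (simp add: c_def)
  next
    fix t assume t: "t \<in> {lo..hi}"
    then obtain j where j: "j < N" "node j \<le> t" "t \<le> node (Suc j)"
      and near: "\<bar>\<phi> t - \<phi> (node j)\<bar> \<le> \<epsilon>" "\<bar>\<phi> t - \<phi> (node (Suc j))\<bar> \<le> \<epsilon>"
      using cell by blast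
    have "(\<Sum>l<N - 1. c l * max 0 (t - node (Suc l))) = (\<Sum>l<j. c l * (t - node (Suc l)))"
    proof (rule sum.mono_neutral_cong_right)
      show "\<forall>l\<in>{..<N - 1} - {..<j}. c l * max 0 (t - node (Suc l)) = 0"
      proof
        fix l assume "l \<in> {..<N - 1} - {..<j}"
        then have "node (Suc j) \<le> node (Suc l)" by (intro node_mono) auto
        with j(3) show "c l * max 0 (t - node (Suc l)) = 0" by simp
      qed
      fix l assume "l \<in> {..<j}"
      then have "node (Suc l) \<le> node j" by (intro node_mono) auto
      with j(2) show "c l * max 0 (t - node (Suc l)) = c l * (t - node (Suc l))" by simp
    qed (use j in auto)
    then have P: "\<phi> lo - \<sigma> 0 * lo + \<sigma> 0 * t + (\<Sum>l<N - 1. c l * max 0 (t - node (Suc l)))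
        = \<phi> (node j) + \<sigma> j * (t - node j)"
      using telescope[OF j(1), of t] by (simp add: algebra_simps)
    have t': "0 \<le> t - node j" "t - node j \<le> h" using j node_Suc[of j] by auto
    \<comment> \<open>Inside a cell the chord lies between its two end values, and both are within
      \<epsilon> of the value at \<open>t\<close>.\<close>
    have "\<sigma> j * (t - node j) \<in> closed_segment 0 (h * \<sigma> j)"
    proof (cases "0 \<le> \<sigma> j")
      case True
      then show ?thesis using t' h_nonneg mult_left_mono[of "t - node j" h "\<sigma> j"]
        by (auto simp: closed_segment_eq_real_ivl mult.commute)
    next
      case False
      then have "h * \<sigma> j \<le> \<sigma> j * (t - node j)" "\<sigma> j * (t - node j) \<le> 0"
        using t' mult_left_mono_neg[of "t - node j" h "\<sigma> j"]
        by (simp_all add: mult.commute mult_nonpos_nonneg)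
      then show ?thesis by (auto simp: closed_segment_eq_real_ivl)
    qed
    then show "\<bar>\<phi> t - (\<phi> lo - \<sigma> 0 * lo + \<sigma> 0 * t + (\<Sum>l<N - 1. c l * max 0 (t - node (Suc l))))\<bar> \<le> \<epsilon>"
      unfolding P using near value_node_Suc[OF j(1)] by (auto simp: closed_segment_eq_real_ivl abs_le_iff split: if_splits)
  qed
qed

text \<open>The concave problem \<open>max\<^sub>u u s - \<phi> u m\<close> written as a sum of hinges in \<open>(s, m)\<close>; the form stays
  meaningful when \<open>m = 0\<close>.\<close>

lemma payoff_le_hinges:
  assumes "t \<in> {lo..hi}" "0 \<le> m"
  shows "t * s - \<phi> t * m \<le> lo * s - \<phi> lo * m + (\<Sum>j<N. h * max 0 (s - \<sigma> j * m)) + \<epsilon> * m"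
proof -
  define R where "R = lo * s - \<phi> lo * m + (\<Sum>j<N. h * max 0 (s - \<sigma> j * m))"
  \<comment> \<open>Moving from node to node collects the gains
    \<open>h * (s - \<sigma> l * m)\<close>; positive parts dominate them, and extending the sum to
    all cells only adds nonnegative terms.\<close>
  have R: "node j * s - \<phi> (node j) * m \<le> R" if "j \<le> N" for j
  proof -
    have "node j * s - \<phi> (node j) * m = lo * s - \<phi> lo * m + (\<Sum>l<j. h * (s - \<sigma> l * m))"
      using value_node[OF that]
      by (simp add: node_def algebra_simps sum_subtractf sum_distrib_left sum_distrib_right)
    also have "(\<Sum>l<j. h * (s - \<sigma> l * m)) \<le> (\<Sum>l<j. h * max 0 (s - \<sigma> l * m))"
      using h_nonneg by (intro sum_mono mult_left_mono) auto
    also have "\<dots> \<le> (\<Sum>l<N. h * max 0 (s - \<sigma> l * m))"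
      using h_nonneg that by (intro sum_mono2) auto
    finally show ?thesis by (simp add: R_def)
  qed
  obtain j where j: "j < N" "node j \<le> t" "t \<le> node (Suc j)"
    "\<bar>\<phi> t - \<phi> (node j)\<bar> \<le> \<epsilon>" "\<bar>\<phi> t - \<phi> (node (Suc j))\<bar> \<le> \<epsilon>"
    using cell[OF assms(1)] by blast
  \<comment> \<open>The sign of \<open>s\<close> decides to which end of its cell \<open>t\<close>
    is moved without lowering \<open>t * s\<close>.\<close>
  have le: "t * s - \<phi> t * m \<le> R + \<epsilon> * m"
    if "t * s \<le> node k * s" "\<bar>\<phi> t - \<phi> (node k)\<bar> \<le> \<epsilon>" "k \<le> N" for k
  proof -
    have "(\<phi> (node k) - \<epsilon>) * m \<le> \<phi> t * m" using that(2) assms(2) by (intro mult_right_mono) auto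
    then show ?thesis using R[OF that(3)] that(1) by (simp add: algebra_simps)
  qed
  have "t * s - \<phi> t * m \<le> R + \<epsilon> * m"
  proof (cases "0 \<le> s")
    case True
    then show ?thesis using j by (intro le[of "Suc j"] mult_right_mono) auto
  next
    case False
    then show ?thesis using j by (intro le[of j] mult_right_mono_neg) auto
  qed
  then show ?thesis by (simp add: R_def)
qed

text \<open>A best node for the linearised problem: advance over every cell whose marginal gain is
  positive. The sum of indicators makes measurability in \<open>s\<close> and \<open>m\<close>
  immediate.\<close>

definition threshold :: "real \<Rightarrow> real \<Rightarrow> real" where
  "threshold s m = lo + (\<Sum>j<N. h * of_bool (\<sigma> j * m < s))"

text \<open>Slopes increase and \<open>0 \<le> m\<close>, so the cells with positive gain form an
  initial segment and the threshold is a node.\<close>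

lemma threshold_attains:
  assumes "0 \<le> m"
  shows "threshold s m \<in> {lo..hi}"
    and "threshold s m * s - \<phi> (threshold s m) * m
      = lo * s - \<phi> lo * m + (\<Sum>j<N. h * max 0 (s - \<sigma> j * m))"
proof -
  have "\<exists>k\<le>N. {j. j < N \<and> \<sigma> j * m < s} = {..<k}"
  proof (rule initial_segment)
    fix i j assume "i \<le> j" "j < N" "\<sigma> j * m < s"
    then show "\<sigma> i * m < s" using mult_right_mono[OF slope_mono[of i j] assms] by linarith
  qed
  then obtain k where k: "k \<le> N" "{j. j < N \<and> \<sigma> j * m < s} = {..<k}" by blast
  have pick: "(\<Sum>j<N. if \<sigma> j * m < s then F j else 0) = (\<Sum>j<k. F j)" for F :: "nat \<Rightarrow> real"
    unfolding k(2)[symmetric] by (simp add: sum.inter_filter[symmetric])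
  have thr: "threshold s m = node k"
    using pick[of "\<lambda>_. h"] by (simp add: threshold_def node_def of_bool_def if_distrib cong: if_cong)
  then show "threshold s m \<in> {lo..hi}" using node_in[OF k(1)] by simp
  have "(\<Sum>j<N. h * max 0 (s - \<sigma> j * m)) = (\<Sum>j<N. if \<sigma> j * m < s then h * (s - \<sigma> j * m) else 0)"
    by (intro sum.cong) auto
  also have "\<dots> = (\<Sum>j<k. h * (s - \<sigma> j * m))" by (rule pick)
  also have "lo * s - \<phi> lo * m + \<dots> = node k * s - \<phi> (node k) * m"
    using value_node[OF k(1)]
    by (simp add: node_def algebra_simps sum_subtractf sum_distrib_left sum_distrib_right)
  finally show "threshold s m * s - \<phi> (threshold s m) * m
      = lo * s - \<phi> lo * m + (\<Sum>j<N. h * max 0 (s - \<sigma> j * m))"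
    unfolding thr by simp
qed

end

lemma chord_grid_exists:
  fixes \<phi> :: "real \<Rightarrow> real"
  assumes le: "lo \<le> hi" and conv: "convex_on {lo..hi} \<phi>" and cont: "continuous_on {lo..hi} \<phi>" and "\<epsilon> > 0"
  obtains N :: nat and h :: real and \<sigma> :: "nat \<Rightarrow> real" where "chord_grid lo hi \<phi> \<epsilon> N h \<sigma>"
proof -
  have "uniformly_continuous_on {lo..hi} \<phi>"
    using cont by (simp add: compact_uniformly_continuous)
  then obtain d where d: "d > 0" "\<And>x y. x \<in> {lo..hi} \<Longrightarrow> y \<in> {lo..hi} \<Longrightarrow> \<bar>x - y\<bar> < d \<Longrightarrow> \<bar>\<phi> x - \<phi> y\<bar> < \<epsilon>"
    using \<open>\<epsilon> > 0\<close> unfolding uniformly_continuous_on_def dist_real_def by metis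
  obtain N :: nat where N: "(hi - lo) / d < real N" using reals_Archimedean2 by blast
  have "0 \<le> (hi - lo) / d" using le d(1) by simp
  then have N0: "0 < N" using N by (cases N) auto
  define h where "h = (hi - lo) / real N"
  have h0: "0 \<le> h" using le by (simp add: h_def)
  have hN: "lo + real N * h = hi" using N0 by (simp add: h_def)
  have hd: "h < d" using N N0 d(1) by (simp add: h_def field_simps)
  define u where "u j = lo + real j * h" for j
  have uin: "u j \<in> {lo..hi}" if "j \<le> N" for j
  proof -
    have "real j * h \<le> real N * h" using that h0 by (intro mult_right_mono) auto
    then show ?thesis using hN h0 by (auto simp: u_def)
  qed
  \<comment> \<open>If \<open>lo = hi\<close> then \<open>h = 0\<close>, and division by zero makes
    every slope 0, which satisfies the increment equation.\<close>
  define \<sigma> where "\<sigma> j = (\<phi> (u (Suc j)) - \<phi> (u j)) / h" for j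
  have step: "\<sigma> j \<le> \<sigma> (Suc j)" if "Suc j < N" for j
  proof -
    \<comment> \<open>Convexity at the midpoint of two cells compares their slopes.\<close>
    have "\<phi> ((1 - 1/2) *\<^sub>R u j + (1/2) *\<^sub>R u (Suc (Suc j))) \<le> (1 - 1/2) * \<phi> (u j) + (1/2) * \<phi> (u (Suc (Suc j)))"
      using that by (intro convex_onD[OF conv] uin) auto
    moreover have "(1 - 1/2) *\<^sub>R u j + (1/2) *\<^sub>R u (Suc (Suc j)) = u (Suc j)"
      by (simp add: u_def algebra_simps)
    ultimately have "\<phi> (u (Suc j)) - \<phi> (u j) \<le> \<phi> (u (Suc (Suc j))) - \<phi> (u (Suc j))" by simp
    then show ?thesis unfolding \<sigma>_def using h0 by (intro divide_right_mono)
  qed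
  have mono: "\<sigma> i \<le> \<sigma> j" if "i \<le> j" "j < N" for i j
    using that by (induction j rule: dec_induct) (auto intro: order_trans step)
  have inc: "\<phi> (u (Suc j)) = \<phi> (u j) + h * \<sigma> j" for j
    by (cases "h = 0") (auto simp: \<sigma>_def u_def)
  have "chord_grid lo hi \<phi> \<epsilon> N h \<sigma>"
    by unfold_locales (use N0 h0 hN mono inc d(2) hd in \<open>auto simp: u_def intro!: less_imp_le\<close>)
  then show ?thesis by (rule that)
qed

section \<open>Contracts over a family of densities\<close>

lemma continuous_interval_bound:
  fixes \<phi> :: "real \<Rightarrow> real"
  assumes "continuous_on {lo..hi} \<phi>"
  obtains B where "0 \<le> B" "\<And>t. t \<in> {lo..hi} \<Longrightarrow> \<bar>\<phi> t\<bar> \<le> B"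
proof -
  have "bounded (\<phi> ` {lo..hi})"
    using assms by (intro compact_imp_bounded compact_continuous_image) auto
  then obtain B where "B > 0" "\<forall>y\<in>\<phi> ` {lo..hi}. \<bar>y\<bar> \<le> B"
    unfolding bounded_pos by auto
  then show ?thesis using that[of B] by auto
qed

locale densities =
  fixes M :: "'a measure" and n :: nat and f :: "nat \<Rightarrow> 'a \<Rightarrow> real"
  assumes integrable_f: "i \<le> n \<Longrightarrow> integrable M (f i)"
    and nonneg_f: "i \<le> n \<Longrightarrow> x \<in> space M \<Longrightarrow> 0 \<le> f i x"
    and integral_f: "i \<le> n \<Longrightarrow> integral\<^sup>L M (f i) = 1"
begin

definition comb :: "(nat \<Rightarrow> real) \<Rightarrow> 'a \<Rightarrow> real" where
  "comb e x = (\<Sum>i\<le>n. e i * f i x)"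

definition contracts :: "real \<Rightarrow> real \<Rightarrow> ('a \<Rightarrow> real) set" where
  "contracts lo hi = {w \<in> borel_measurable M. \<forall>x\<in>space M. w x \<in> {lo..hi}}"

lemma integrable_comb [simp]: "integrable M (comb e)"
  unfolding comb_def using integrable_f by (auto intro!: Bochner_Integration.integrable_sum integrable_mult_right)

lemma measurable_f [measurable (raw)]: "i \<le> n \<Longrightarrow> f i \<in> borel_measurable M"
  using integrable_f by (rule borel_measurable_integrable)

lemma measurable_comb [measurable]: "comb e \<in> borel_measurable M"
  using integrable_comb by (rule borel_measurable_integrable)

lemma integral_comb: "integral\<^sup>L M (comb e) = (\<Sum>i\<le>n. e i)"
  unfolding comb_def using integrable_f integral_f by (subst Bochner_Integration.integral_sum) auto

lemma comb_nonneg: "(\<And>i. i \<le> n \<Longrightarrow> 0 \<le> e i) \<Longrightarrow> x \<in> space M \<Longrightarrow> 0 \<le> comb e x"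
  unfolding comb_def using nonneg_f by (auto intro!: sum_nonneg)

lemma comb_linear: "s * comb d x + t * comb e x = comb (\<lambda>i. s * d i + t * e i) x"
  by (simp add: comb_def sum_distrib_left sum.distrib algebra_simps)

lemma integrable_bounded_mult:
  fixes h w :: "'a \<Rightarrow> real"
  assumes "integrable M h" "w \<in> borel_measurable M" "\<And>x. x \<in> space M \<Longrightarrow> \<bar>w x\<bar> \<le> B"
  shows "integrable M (\<lambda>x. w x * h x)"
proof (rule Bochner_Integration.integrable_bound)
  show "integrable M (\<lambda>x. B * h x)" using assms(1) by simp
  show "(\<lambda>x. w x * h x) \<in> borel_measurable M"
    using assms(2) borel_measurable_integrable[OF assms(1)] by simp
  have "\<bar>w x\<bar> * \<bar>h x\<bar> \<le> \<bar>B\<bar> * \<bar>h x\<bar>" if "x \<in> space M" for x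
    using assms(3)[OF that] by (intro mult_right_mono) auto
  then show "AE x in M. norm (w x * h x) \<le> norm (B * h x)"
    by (auto simp: abs_mult)
qed

lemma contracts_measurable: "w \<in> contracts lo hi \<Longrightarrow> w \<in> borel_measurable M"
  by (simp add: contracts_def)

lemma contracts_range: "w \<in> contracts lo hi \<Longrightarrow> x \<in> space M \<Longrightarrow> w x \<in> {lo..hi}"
  by (simp add: contracts_def)

lemma contracts_convex:
  assumes "u \<in> contracts lo hi" "v \<in> contracts lo hi" "0 \<le> t" "t \<le> 1"
  shows "(\<lambda>x. (1 - t) * u x + t * v x) \<in> contracts lo hi"
proof -
  have "(1 - t) * u x + t * v x \<in> {lo..hi}" if "x \<in> space M" for x
    using convexD_alt[OF convex_real_interval(5), of "u x" lo hi "v x" t] assms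
      contracts_range[OF assms(1) that] contracts_range[OF assms(2) that] by auto
  then show ?thesis using assms unfolding contracts_def by auto
qed

lemma continuous_compose_contract:
  fixes \<phi> :: "real \<Rightarrow> real"
  assumes "w \<in> contracts lo hi" "continuous_on {lo..hi} \<phi>"
  shows "(\<lambda>x. \<phi> (w x)) \<in> borel_measurable M"
proof -
  have "w \<in> measurable M (restrict_space borel {lo..hi})"
    using assms(1) by (auto simp: contracts_def intro!: measurable_restrict_space2)
  from measurable_compose[OF this borel_measurable_continuous_on_restrict[OF assms(2)]]
  show ?thesis .
qed

lemma integrable_compose_contract:
  fixes \<phi> :: "real \<Rightarrow> real"
  assumes "w \<in> contracts lo hi" "continuous_on {lo..hi} \<phi>" "integrable M h"
  shows "integrable M (\<lambda>x. \<phi> (w x) * h x)"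
proof -
  obtain B where "\<And>t. t \<in> {lo..hi} \<Longrightarrow> \<bar>\<phi> t\<bar> \<le> B"
    using continuous_interval_bound[OF assms(2)] by blast
  then show ?thesis
    using contracts_range[OF assms(1)]
    by (intro integrable_bounded_mult[OF assms(3) continuous_compose_contract[OF assms(1,2)]]) auto
qed

lemma integrable_contract:
  "w \<in> contracts lo hi \<Longrightarrow> integrable M h \<Longrightarrow> integrable M (\<lambda>x. w x * h x)"
  using integrable_compose_contract[where \<phi>="\<lambda>x. x"] by auto

text \<open>Almost-minimisers of \<open>\<integral> w\<^sup>2\<close> in the nested convex sublevel sets of \<open>\<Phi>\<close> are Cauchy by the
  parallelogram identity; this replaces weak compactness.\<close>

lemma convex_functional_attains_inf:
  fixes \<Phi> :: "('a \<Rightarrow> real) \<Rightarrow> real"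
  assumes le: "lo \<le> hi"
    and nonneg: "\<And>w. w \<in> contracts lo hi \<Longrightarrow> 0 \<le> \<Phi> w"
    and mid: "\<And>u v. u \<in> contracts lo hi \<Longrightarrow> v \<in> contracts lo hi \<Longrightarrow>
        \<Phi> (\<lambda>x. (1 - 1/2) * u x + 1/2 * v x) \<le> max (\<Phi> u) (\<Phi> v)"
    and cont: "\<And>u w. (\<And>k. u k \<in> contracts lo hi) \<Longrightarrow> w \<in> contracts lo hi \<Longrightarrow>
        AE x in M. 0 < comb (\<lambda>_. 1) x \<longrightarrow> (\<lambda>k. u k x) \<longlonglongrightarrow> w x \<Longrightarrow> (\<lambda>k. \<Phi> (u k)) \<longlonglongrightarrow> \<Phi> w"
  obtains w where "w \<in> contracts lo hi" "\<And>u. u \<in> contracts lo hi \<Longrightarrow> \<Phi> w \<le> \<Phi> u"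
proof -
  \<comment> \<open>The total density is an integrable weight, and where it vanishes so does every
    density: contracts matter only where it is positive.\<close>
  define m where "m = comb (\<lambda>_. 1)"
  have m_int [simp]: "integrable M m" by (simp add: m_def)
  have m_meas [measurable]: "m \<in> borel_measurable M" by (simp add: m_def)
  have m0: "0 \<le> m x" if "x \<in> space M" for x using that comb_nonneg by (simp add: m_def)
  define W where "W = contracts lo hi"
  define Q where "Q h = (LINT x|M. (h x)\<^sup>2 * m x)" for h
  define B where "B = max \<bar>lo\<bar> \<bar>hi\<bar>"
  have wB: "\<bar>w x\<bar> \<le> B" if "w \<in> W" "x \<in> space M" for w x
    using contracts_range[OF that[unfolded W_def]] by (auto simp: B_def)
  have meas: "w \<in> borel_measurable M" if "w \<in> W" for w
    using that contracts_measurable by (simp add: W_def)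
  have prod_int: "integrable M (\<lambda>x. (u x * v x) * m x)" if "u \<in> W" "v \<in> W" for u v
  proof (rule integrable_bounded_mult[OF m_int])
    show "(\<lambda>x. u x * v x) \<in> borel_measurable M" using meas[OF that(1)] meas[OF that(2)] by measurable
    show "\<bar>u x * v x\<bar> \<le> B * B" if "x \<in> space M" for x
      using wB that \<open>u \<in> W\<close> \<open>v \<in> W\<close> by (auto simp: abs_mult intro: mult_mono')
  qed
  have sq_int: "integrable M (\<lambda>x. (u x)\<^sup>2 * m x)" if "u \<in> W" for u
    using prod_int[OF that that] by (simp add: power2_eq_square)
  have Q0: "0 \<le> Q h" for h
    unfolding Q_def using m0 by (intro Bochner_Integration.integral_nonneg) auto
  have QB: "Q w \<le> B\<^sup>2 * integral\<^sup>L M m" if "w \<in> W" for w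
  proof -
    have "Q w \<le> (LINT x|M. B\<^sup>2 * m x)" unfolding Q_def
    proof (rule integral_mono)
      show "(w x)\<^sup>2 * m x \<le> B\<^sup>2 * m x" if "x \<in> space M" for x
        using wB[OF \<open>w \<in> W\<close> that] m0[OF that] abs_le_square_iff[of "w x" B]
        by (intro mult_right_mono) (auto simp: B_def)
    qed (use sq_int that in auto)
    then show ?thesis by simp
  qed
  have midW: "(\<lambda>x. (1 - 1/2) * u x + 1/2 * v x) \<in> W" if "u \<in> W" "v \<in> W" for u v
    using contracts_convex[of u lo hi v "1/2"] that by (simp add: W_def)
  have par: "Q (\<lambda>x. u x - v x) = 2 * Q u + 2 * Q v - 4 * Q (\<lambda>x. (1 - 1/2) * u x + 1/2 * v x)"
    if "u \<in> W" "v \<in> W" for u v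
  proof -
    note i = sq_int[OF that(1)] sq_int[OF that(2)] sq_int[OF midW[OF that]]
    have "Q (\<lambda>x. u x - v x) = (LINT x|M. 2 * ((u x)\<^sup>2 * m x) + 2 * ((v x)\<^sup>2 * m x)
        - 4 * (((1 - 1/2) * u x + 1/2 * v x)\<^sup>2 * m x))"
      unfolding Q_def by (intro Bochner_Integration.integral_cong) (auto simp: power2_eq_square field_simps)
    also have "\<dots> = 2 * Q u + 2 * Q v - 4 * Q (\<lambda>x. (1 - 1/2) * u x + 1/2 * v x)"
      unfolding Q_def using i by simp
    finally show ?thesis .
  qed
  define D where "D = Inf (\<Phi> ` W)"
  have const: "(\<lambda>_. lo) \<in> W" using le by (simp add: W_def contracts_def)
  have bdd: "bdd_below (\<Phi> ` W)" using nonneg by (intro bdd_belowI2[of _ 0]) (simp add: W_def)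
  have D_le: "D \<le> \<Phi> w" if "w \<in> W" for w unfolding D_def using that bdd by (simp add: cInf_lower)
  define S where "S k = {w \<in> W. \<Phi> w \<le> D + 1 / real (Suc k)}" for k
  have S_ne: "S k \<noteq> {}" for k
  proof -
    have "\<exists>y\<in>\<Phi> ` W. y < D + 1 / real (Suc k)"
      unfolding D_def
    proof (rule cInf_lessD)
      show "\<Phi> ` W \<noteq> {}" using const by blast
    qed simp
    then obtain w where "w \<in> W" "\<Phi> w < D + 1 / real (Suc k)" by blast
    then have "w \<in> S k" unfolding S_def by simp
    then show ?thesis by blast
  qed
  have S_dec: "S l \<subseteq> S k" if "k \<le> l" for k l
  proof -
    have "1 / real (Suc l) \<le> 1 / real (Suc k)" using that by (simp add: frac_le)
    then show ?thesis unfolding S_def by (blast intro: order_trans[OF _ add_left_mono])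
  qed
  have S_mid: "(\<lambda>x. (1 - 1/2) * u x + 1/2 * v x) \<in> S k" if "u \<in> S k" "v \<in> S k" for u v k
  proof -
    have "u \<in> W" "v \<in> W" and le: "max (\<Phi> u) (\<Phi> v) \<le> D + 1 / real (Suc k)"
      using that by (simp_all add: S_def)
    then show ?thesis
      using midW[of u v] order_trans[OF mid le] unfolding S_def W_def by blast
  qed
  \<comment> \<open>The sublevel sets shrink, so these infima increase; being bounded they converge,
    and this drives the Cauchy estimate.\<close>
  define A where "A k = Inf (Q ` S k)" for k
  have bddQ: "bdd_below (Q ` S k)" for k using Q0 by (intro bdd_belowI2[of _ 0]) simp
  have A_le: "A k \<le> Q w" if "w \<in> S k" for w k
    unfolding A_def using that bddQ by (simp add: cInf_lower)
  have "\<exists>w\<in>S k. Q w < A k + 1 / real (Suc k)" for k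
  proof -
    have "\<exists>y\<in>Q ` S k. y < A k + 1 / real (Suc k)"
      unfolding A_def
    proof (rule cInf_lessD)
      show "Q ` S k \<noteq> {}" using S_ne by blast
    qed simp
    then show ?thesis by blast
  qed
  then obtain u where u: "\<And>k. u k \<in> S k" "\<And>k. Q (u k) < A k + 1 / real (Suc k)" by metis
  have uW: "u k \<in> W" for k using u(1) by (auto simp: S_def)
  have "incseq A"
  proof (rule incseq_SucI)
    show "A k \<le> A (Suc k)" for k
      unfolding A_def
      using S_dec[of k "Suc k"] S_ne bddQ by (intro cInf_superset_mono image_mono) simp_all
  qed
  moreover have "A k \<le> B\<^sup>2 * integral\<^sup>L M m" for k
    using A_le[OF u(1)] QB[OF uW] by (rule order_trans)
  ultimately have "convergent A"
    using incseq_convergent[of A "B\<^sup>2 * integral\<^sup>L M m"] unfolding convergent_def by blast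
  then have "Cauchy A" by (rule convergent_Cauchy)
  have Qdiff: "Q (\<lambda>x. u k x - u l x) \<le> 2 * \<bar>A l - A k\<bar> + 4 * (1 / real (Suc k))" if "k \<le> l" for k l
  proof -
    have ul: "u l \<in> S k" using u(1) S_dec[OF that] by blast
    define q where "q = Q (\<lambda>x. (1 - 1/2) * u k x + 1/2 * u l x)"
    define d where "d = Q (\<lambda>x. u k x - u l x)"
    \<comment> \<open>The midpoint stays in \<open>S k\<close>, so its quadratic value is at least
      \<open>A k\<close>. The parallelogram identity then leaves only \<open>A l - A k\<close> and
      the two tolerances.\<close>
    have "A k \<le> q" unfolding q_def by (rule A_le[OF S_mid[OF u(1) ul]])
    moreover have "1 / real (Suc l) \<le> 1 / real (Suc k)" using that by (simp add: frac_le)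
    moreover have "d = 2 * Q (u k) + 2 * Q (u l) - 4 * q" unfolding d_def q_def by (rule par[OF uW uW])
    moreover note u(2)[of k] u(2)[of l]
    ultimately have "d \<le> 2 * \<bar>A l - A k\<bar> + 4 * (1 / real (Suc k))" by argo
    then show ?thesis unfolding d_def .
  qed
  define I where "I = integral\<^sup>L M m"
  have I0: "0 \<le> I" unfolding I_def using m0 by (intro Bochner_Integration.integral_nonneg) auto
  \<comment> \<open>Passage from quadratic to absolute distance by
    \<open>h \<le> \<eta> + h\<^sup>2 / \<eta>\<close>, in place of Cauchy-Schwarz: mean convergence
    provides a subsequence that is Cauchy almost everywhere.\<close>
  have L1: "(LINT x|M. norm (u k x * m x - u l x * m x)) \<le> \<eta> * I + Q (\<lambda>x. u k x - u l x) / \<eta>"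
    if "\<eta> > 0" for \<eta> k l
  proof -
    have i: "integrable M (\<lambda>x. (u k x - u l x)\<^sup>2 * m x)"
    proof -
      have "integrable M (\<lambda>x. (u k x)\<^sup>2 * m x + (u l x)\<^sup>2 * m x - 2 * ((u k x * u l x) * m x))"
        using sq_int[OF uW] prod_int[OF uW uW] by simp
      then show ?thesis by (simp add: power2_eq_square algebra_simps)
    qed
    have i1: "integrable M (\<lambda>x. u k x * m x)" for k
      using integrable_contract[OF uW[unfolded W_def] m_int] .
    have "(LINT x|M. norm (u k x * m x - u l x * m x)) \<le> (LINT x|M. \<eta> * m x + (u k x - u l x)\<^sup>2 * m x / \<eta>)"
    proof (rule integral_mono)
      fix x assume x: "x \<in> space M"
      define h where "h = \<bar>u k x - u l x\<bar>"
      have "h \<le> \<eta> + h\<^sup>2 / \<eta>"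
      proof (cases "h \<le> \<eta>")
        case False
        then have "h * \<eta> \<le> h * h" using that by (intro mult_left_mono) auto
        then have "h \<le> h\<^sup>2 / \<eta>" using that by (simp add: power2_eq_square field_simps)
        then show ?thesis using that by linarith
      qed (use that in \<open>auto intro: add_increasing2\<close>)
      then have "h * m x \<le> (\<eta> + h\<^sup>2 / \<eta>) * m x" using m0[OF x] by (rule mult_right_mono)
      moreover have "norm (u k x * m x - u l x * m x) = h * m x"
        using m0[OF x] by (simp add: h_def abs_mult flip: left_diff_distrib)
      ultimately show "norm (u k x * m x - u l x * m x) \<le> \<eta> * m x + (u k x - u l x)\<^sup>2 * m x / \<eta>"
        by (simp add: h_def algebra_simps)
    qed (use i i1 in auto)
    also have "\<dots> = \<eta> * I + Q (\<lambda>x. u k x - u l x) / \<eta>"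
      unfolding Q_def I_def using i by simp
    finally show ?thesis .
  qed
  have um: "integrable M (\<lambda>x. u k x * m x)" for k
    using integrable_contract[OF uW[unfolded W_def] m_int] .
  have ev: "\<exists>N. \<forall>i\<ge>N. \<forall>j\<ge>N. (LINT x|M. norm (u i x * m x - u j x * m x)) < e" if "e > 0" for e
  proof -
    \<comment> \<open>Chosen so that the first term of \<open>L1\<close> is at most
      \<open>e / 2\<close>; adding 1 keeps the denominator positive.\<close>
    define \<eta> where "\<eta> = e / (2 * (I + 1))"
    have \<eta>: "\<eta> > 0" using that I0 by (simp add: \<eta>_def)
    have "\<eta> * I \<le> e / 2" using that I0 by (simp add: \<eta>_def field_simps)
    have "0 < \<eta> * e / 16" using \<eta> that by simp
    then obtain N1 where N1: "\<And>i j. i \<ge> N1 \<Longrightarrow> j \<ge> N1 \<Longrightarrow> \<bar>A i - A j\<bar> < \<eta> * e / 16"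
      using \<open>Cauchy A\<close> unfolding Cauchy_def dist_real_def by blast
    obtain N2 :: nat where N2: "32 / (\<eta> * e) < real N2" using reals_Archimedean2 by blast
    have *: "(LINT x|M. norm (u i x * m x - u j x * m x)) < e" if "max N1 N2 \<le> i" "i \<le> j" for i j
    proof -
      have "32 / (\<eta> * e) < real (Suc i)" using N2 that by linarith
      then have "4 * (1 / real (Suc i)) < \<eta> * e / 8"
        using \<eta> \<open>e > 0\<close> by (simp add: field_simps)
      then have "Q (\<lambda>x. u i x - u j x) < \<eta> * e / 2"
        using Qdiff[OF that(2)] N1[of j i] that mult_pos_pos[OF \<eta> \<open>e > 0\<close>] by simp
      then have "Q (\<lambda>x. u i x - u j x) / \<eta> < e / 2"
        using \<eta> by (simp add: field_simps)
      then show ?thesis using L1[OF \<eta>, of i j] \<open>\<eta> * I \<le> e / 2\<close> by linarith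
    qed
    have "(LINT x|M. norm (u i x * m x - u j x * m x)) < e" if "max N1 N2 \<le> i" "max N1 N2 \<le> j" for i j
    proof (cases "i \<le> j")
      case False
      then show ?thesis using *[of j i] that by (simp add: abs_minus_commute)
    qed (use * that in auto)
    then show ?thesis by blast
  qed
  obtain r where r: "strict_mono r" "AE x in M. Cauchy (\<lambda>i. u (r i) x * m x)"
    using cauchy_L1_AE_cauchy_subseq[OF um ev] by blast
  \<comment> \<open>The value of \<open>lim\<close> is unspecified where the sequence diverges;
    clamping makes \<open>w\<close> a contract everywhere and changes nothing at points of
    convergence.\<close>
  define w where "w x = max lo (min hi (lim (\<lambda>i. u (r i) x)))" for x
  have wW: "w \<in> W"
  proof -
    have "(\<lambda>x. lim (\<lambda>i. u (r i) x)) \<in> borel_measurable M"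
      using meas[OF uW] by (intro borel_measurable_lim_metric)
    then have "w \<in> borel_measurable M" unfolding w_def by measurable
    then show ?thesis using le by (auto simp: W_def contracts_def w_def)
  qed
  have "AE x in M. 0 < m x \<longrightarrow> (\<lambda>k. u (r k) x) \<longlonglongrightarrow> w x"
    using r(2) AE_space
  proof eventually_elim
    case (elim x)
    show ?case
    proof
      assume mx: "0 < m x"
      have "Cauchy (\<lambda>i. inverse (m x) * (u (r i) x * m x))"
        using elim(1) by (rule bounded_linear.Cauchy[OF bounded_linear_mult_right])
      then have "Cauchy (\<lambda>i. u (r i) x)" using mx by (simp add: field_simps)
      then have l: "(\<lambda>i. u (r i) x) \<longlonglongrightarrow> lim (\<lambda>i. u (r i) x)"
        by (simp add: Cauchy_convergent_iff convergent_LIMSEQ_iff)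
      have "lim (\<lambda>i. u (r i) x) \<in> {lo..hi}"
        using contracts_range[OF uW[unfolded W_def] elim(2)]
        by (intro closed_sequentially[OF closed_atLeastAtMost _ l]) auto
      with l show "(\<lambda>k. u (r k) x) \<longlonglongrightarrow> w x" by (simp add: w_def)
    qed
  qed
  then have "(\<lambda>k. \<Phi> (u (r k))) \<longlonglongrightarrow> \<Phi> w"
    using uW wW by (intro cont) (auto simp: W_def m_def)
  moreover have "(\<lambda>k. D + 1 / real (Suc (r k))) \<longlonglongrightarrow> D"
    using LIMSEQ_subseq_LIMSEQ[OF LIMSEQ_inverse_real_of_nat_add[of D] r(1)]
    by (simp add: o_def inverse_eq_divide)
  moreover have "\<Phi> (u (r k)) \<le> D + 1 / real (Suc (r k))" for k
    using u(1)[of "r k"] by (simp add: S_def)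
  ultimately have "\<Phi> w \<le> D" using LIMSEQ_le by blast
  then show ?thesis using that[of w] wW order_trans[OF _ D_le] unfolding W_def by blast
qed

lemma comb_eq_0:
  assumes "x \<in> space M" "\<not> 0 < comb (\<lambda>_. 1) x"
  shows "comb e x = 0"
proof -
  have "(\<Sum>i\<le>n. f i x) = 0"
    using assms comb_nonneg[of "\<lambda>_. 1" x] by (simp add: comb_def)
  then have "f i x = 0" if "i \<le> n" for i
    using nonneg_f[OF _ assms(1)] that by (subst (asm) sum_nonneg_eq_0_iff) auto
  then show ?thesis by (simp add: comb_def)
qed

text \<open>Dominated convergence; where the total density is 0, the integrands vanish by
  \<open>comb_eq_0\<close>, so no convergence of the contracts is asked for there.\<close>

lemma tendsto_integral_contract:
  fixes \<phi> :: "real \<Rightarrow> real"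
  assumes u: "\<And>k. u k \<in> contracts lo hi" and w: "w \<in> contracts lo hi"
    and ae: "AE x in M. 0 < comb (\<lambda>_. 1) x \<longrightarrow> (\<lambda>k. u k x) \<longlonglongrightarrow> w x"
    and cont: "continuous_on {lo..hi} \<phi>"
  shows "(\<lambda>k. LINT x|M. \<phi> (u k x) * comb e x) \<longlonglongrightarrow> (LINT x|M. \<phi> (w x) * comb e x)"
proof -
  obtain B where B: "\<And>t. t \<in> {lo..hi} \<Longrightarrow> \<bar>\<phi> t\<bar> \<le> B"
    using continuous_interval_bound[OF cont] by blast
  show ?thesis
  proof (rule integral_dominated_convergence[where w="\<lambda>x. B * \<bar>comb e x\<bar>"])
    show "(\<lambda>x. \<phi> (w x) * comb e x) \<in> borel_measurable M"
      using continuous_compose_contract[OF w cont] by measurable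
    show "(\<lambda>x. \<phi> (u k x) * comb e x) \<in> borel_measurable M" for k
      using continuous_compose_contract[OF u cont] by measurable
    show "AE x in M. (\<lambda>k. \<phi> (u k x) * comb e x) \<longlonglongrightarrow> \<phi> (w x) * comb e x"
      using ae AE_space
    proof eventually_elim
      case (elim x)
      show ?case
      proof (cases "0 < comb (\<lambda>_. 1) x")
        case True
        then have "(\<lambda>k. \<phi> (u k x)) \<longlonglongrightarrow> \<phi> (w x)"
          using elim contracts_range[OF u] contracts_range[OF w]
          by (intro continuous_on_tendsto_compose[OF cont]) auto
        then show ?thesis by (intro tendsto_intros)
      next
        case False
        then show ?thesis using comb_eq_0[OF elim(2)] by simp
      qed
    qed
    show "AE x in M. norm (\<phi> (u k x) * comb e x) \<le> B * \<bar>comb e x\<bar>" for k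
      using B contracts_range[OF u] by (intro AE_I2) (auto simp: abs_mult intro: mult_right_mono)
  qed simp
qed

section \<open>Attainable moments and costs\<close>

definition moment :: "('a \<Rightarrow> real) \<Rightarrow> nat \<Rightarrow> real" where
  "moment w i = (LINT x|M. w x * f i x)"

lemma f_eq_comb: "i \<le> n \<Longrightarrow> f i x = comb (\<lambda>j. of_bool (j = i)) x"
  using Int_absorb1[of "{i}" "{..n}"] by (simp add: comb_def sum_of_bool_mult_eq Collect_conv_if)

lemma integral_contract_comb:
  assumes "w \<in> contracts lo hi"
  shows "(LINT x|M. w x * comb r x) = (\<Sum>i\<le>n. r i * moment w i)"
proof -
  have "(LINT x|M. w x * comb r x) = (LINT x|M. (\<Sum>i\<le>n. r i * (w x * f i x)))"
    by (simp add: comb_def sum_distrib_left algebra_simps)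
  also have "\<dots> = (\<Sum>i\<le>n. r i * moment w i)"
    using integrable_contract[OF assms integrable_f]
    by (subst Bochner_Integration.integral_sum) (auto simp: moment_def)
  finally show ?thesis .
qed

lemma moment_mix:
  assumes "u \<in> contracts lo hi" "v \<in> contracts lo hi" "i \<le> n"
  shows "moment (\<lambda>x. (1 - t) * u x + t * v x) i = (1 - t) * moment u i + t * moment v i"
proof -
  note int = integrable_contract[OF assms(1) integrable_f[OF assms(3)]]
    integrable_contract[OF assms(2) integrable_f[OF assms(3)]]
  have "moment (\<lambda>x. (1 - t) * u x + t * v x) i = (LINT x|M. (1 - t) * (u x * f i x) + t * (v x * f i x))"
    unfolding moment_def by (simp add: algebra_simps)
  then show ?thesis unfolding moment_def using int by simp
qed

lemma cost_mix:
  assumes u: "u \<in> contracts lo hi" and v: "v \<in> contracts lo hi"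
    and t: "0 \<le> t" "t \<le> 1"
    and cont: "continuous_on {lo..hi} \<phi>" and conv: "convex_on {lo..hi} \<phi>"
    and e: "\<And>i. i \<le> n \<Longrightarrow> 0 \<le> e i"
  shows "(LINT x|M. \<phi> ((1 - t) * u x + t * v x) * comb e x)
    \<le> (1 - t) * (LINT x|M. \<phi> (u x) * comb e x) + t * (LINT x|M. \<phi> (v x) * comb e x)"
proof -
  note int = integrable_compose_contract[OF u cont integrable_comb[of e]]
    integrable_compose_contract[OF v cont integrable_comb[of e]]
    integrable_compose_contract[OF contracts_convex[OF u v t] cont integrable_comb[of e]]
  have "(LINT x|M. \<phi> ((1 - t) * u x + t * v x) * comb e x)
    \<le> (LINT x|M. (1 - t) * (\<phi> (u x) * comb e x) + t * (\<phi> (v x) * comb e x))"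
  proof (rule integral_mono)
    fix x assume x: "x \<in> space M"
    have "\<phi> ((1 - t) * u x + t * v x) \<le> (1 - t) * \<phi> (u x) + t * \<phi> (v x)"
      using convex_onD[OF conv t, of "u x" "v x"] contracts_range[OF u x] contracts_range[OF v x] by simp
    from mult_right_mono[OF this comb_nonneg[OF e x]]
    show "\<phi> ((1 - t) * u x + t * v x) * comb e x \<le> (1 - t) * (\<phi> (u x) * comb e x) + t * (\<phi> (v x) * comb e x)"
      by (simp add: algebra_simps)
  qed (use int in auto)
  then show ?thesis using int by simp
qed

text \<open>Projects \<open>(v, \<tau>)\<close> onto the convex set of attainable moments and costs: the residual
  \<open>(r, \<rho>)\<close> of the projection is a separating direction, which \<open>support\<close> rules out.\<close>

lemma moments_attained:
  fixes \<phi> :: "real \<Rightarrow> real"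
  assumes le: "lo \<le> hi" and cont: "continuous_on {lo..hi} \<phi>" and conv: "convex_on {lo..hi} \<phi>"
    and e: "\<And>i. i \<le> n \<Longrightarrow> 0 \<le> e i"
    and support: "\<And>r \<rho> \<eta>. 0 \<le> \<rho> \<Longrightarrow> 0 < \<eta> \<Longrightarrow> \<exists>w\<in>contracts lo hi.
      (\<Sum>i\<le>n. r i * v i) - \<rho> * \<tau> - \<eta>
        \<le> (\<Sum>i\<le>n. r i * moment w i) - \<rho> * (LINT x|M. \<phi> (w x) * comb e x)"
  obtains w where "w \<in> contracts lo hi" "\<And>i. i \<le> n \<Longrightarrow> moment w i = v i"
    "(LINT x|M. \<phi> (w x) * comb e x) \<le> \<tau>"
proof -
  define cost where "cost w = (LINT x|M. \<phi> (w x) * comb e x)" for w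
  \<comment> \<open>Squared distance from the moments and cost of \<open>w\<close> to the target:
    moments exactly \<open>v\<close>, cost at most \<tau>.\<close>
  define \<Phi> where "\<Phi> w = (\<Sum>i\<le>n. (moment w i - v i)\<^sup>2) + (max 0 (cost w - \<tau>))\<^sup>2" for w
  have cost_mix': "cost (\<lambda>x. (1 - t) * u x + t * w x) \<le> (1 - t) * cost u + t * cost w"
    if "u \<in> contracts lo hi" "w \<in> contracts lo hi" "0 \<le> t" "t \<le> 1" for u w t
    unfolding cost_def using cost_mix[OF that cont conv e] .
  obtain w where w: "w \<in> contracts lo hi" and w_min: "\<And>u. u \<in> contracts lo hi \<Longrightarrow> \<Phi> w \<le> \<Phi> u"
  proof (rule convex_functional_attains_inf[OF le, where \<Phi>=\<Phi>])
    show "0 \<le> \<Phi> w" for w by (auto simp: \<Phi>_def intro!: add_nonneg_nonneg sum_nonneg)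
  next
    fix u w assume uw: "u \<in> contracts lo hi" "w \<in> contracts lo hi"
    define mid where "mid = (\<lambda>x. (1 - 1/2) * u x + 1/2 * w x)"
    have half: "((a + b) / 2)\<^sup>2 \<le> (a\<^sup>2 + b\<^sup>2) / 2" for a b :: real
      using sum_squares_ge_zero[of "a - b" 0] by (simp add: power2_eq_square field_simps)
    have m: "(moment mid i - v i)\<^sup>2 \<le> ((moment u i - v i)\<^sup>2 + (moment w i - v i)\<^sup>2) / 2" if "i \<le> n" for i
    proof -
      have "moment mid i - v i = ((moment u i - v i) + (moment w i - v i)) / 2"
        unfolding mid_def using moment_mix[OF uw that, of "1/2"] by (simp add: field_simps)
      then show ?thesis using half by metis
    qed
    have "cost mid \<le> (cost u + cost w) / 2"
      using cost_mix'[OF uw, of "1/2"] unfolding mid_def by simp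
    then have "max 0 (cost mid - \<tau>) \<le> (max 0 (cost u - \<tau>) + max 0 (cost w - \<tau>)) / 2"
      by (auto simp: max_def)
    then have "(max 0 (cost mid - \<tau>))\<^sup>2 \<le> ((max 0 (cost u - \<tau>) + max 0 (cost w - \<tau>)) / 2)\<^sup>2"
      by (intro power_mono) auto
    also note half
    finally have c: "(max 0 (cost mid - \<tau>))\<^sup>2 \<le> ((max 0 (cost u - \<tau>))\<^sup>2 + (max 0 (cost w - \<tau>))\<^sup>2) / 2" .
    have "(\<Sum>i\<le>n. (moment mid i - v i)\<^sup>2) \<le> (\<Sum>i\<le>n. ((moment u i - v i)\<^sup>2 + (moment w i - v i)\<^sup>2) / 2)"
      using m by (intro sum_mono) auto
    with c have "\<Phi> mid \<le> (\<Phi> u + \<Phi> w) / 2"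
      unfolding \<Phi>_def by (simp add: sum.distrib sum_divide_distrib[symmetric] add_divide_distrib)
    then show "\<Phi> (\<lambda>x. (1 - 1/2) * u x + 1/2 * w x) \<le> max (\<Phi> u) (\<Phi> w)"
      unfolding mid_def[symmetric] by (auto simp: max_def)
  next
    fix u w assume u: "\<And>k. u k \<in> contracts lo hi" and w: "w \<in> contracts lo hi"
      and ae: "AE x in M. 0 < comb (\<lambda>_. 1) x \<longrightarrow> (\<lambda>k. u k x) \<longlonglongrightarrow> w x"
    have "(\<lambda>k. cost (u k)) \<longlonglongrightarrow> cost w"
      unfolding cost_def by (rule tendsto_integral_contract[OF u w ae cont])
    moreover have "(\<lambda>k. moment (u k) i) \<longlonglongrightarrow> moment w i" if "i \<le> n" for i
      unfolding moment_def f_eq_comb[OF that]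
      by (rule tendsto_integral_contract[OF u w ae continuous_on_id])
    ultimately show "(\<lambda>k. \<Phi> (u k)) \<longlonglongrightarrow> \<Phi> w"
      unfolding \<Phi>_def by (auto intro!: tendsto_intros)
  qed blast
  define r where "r i = moment w i - v i" for i
  define \<rho> where "\<rho> = max 0 (cost w - \<tau>)"
  \<comment> \<open>The variational inequality of a projection, obtained by moving from
    \<open>w\<close> slightly towards \<open>u\<close>.\<close>
  have first_order: "0 \<le> (\<Sum>i\<le>n. r i * (moment u i - moment w i)) + \<rho> * (cost u - cost w)"
    if u: "u \<in> contracts lo hi" for u
  proof -
    define d where "d i = moment u i - moment w i" for i
    define D where "D = cost u - cost w"
    define L where "L = (\<Sum>i\<le>n. r i * d i) + \<rho> * D"
    define K where "K = (\<Sum>i\<le>n. (d i)\<^sup>2) + D\<^sup>2"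
    have K0: "0 \<le> K" by (auto simp: K_def intro!: add_nonneg_nonneg sum_nonneg)
    have pert: "0 \<le> 2 * L + t * K" if t: "0 < t" "t \<le> 1" for t
    proof -
      define z where "z = (\<lambda>x. (1 - t) * w x + t * u x)"
      have z: "z \<in> contracts lo hi" unfolding z_def using contracts_convex[OF w u] t by simp
      have mz: "moment z i - v i = r i + t * d i" if "i \<le> n" for i
        unfolding z_def moment_mix[OF w u that] by (simp add: r_def d_def algebra_simps)
      have "cost z - \<tau> \<le> (cost w - \<tau>) + t * D"
        using cost_mix'[OF w u, of t] t by (simp add: z_def D_def algebra_simps)
      \<comment> \<open>If the cost constraint is slack then \<rho> is 0, still an upper bound for
        \<open>cost w - \<tau>\<close>.\<close>
      then have "max 0 (cost z - \<tau>) \<le> \<bar>\<rho> + t * D\<bar>" by (auto simp: \<rho>_def max_def)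
      then have cz: "(max 0 (cost z - \<tau>))\<^sup>2 \<le> (\<rho> + t * D)\<^sup>2"
        using power_mono[of "max 0 (cost z - \<tau>)" "\<bar>\<rho> + t * D\<bar>" 2] by simp
      have "(\<Sum>i\<le>n. (r i)\<^sup>2) + \<rho>\<^sup>2 \<le> (\<Sum>i\<le>n. (r i + t * d i)\<^sup>2) + (\<rho> + t * D)\<^sup>2"
        using w_min[OF z] cz mz unfolding \<Phi>_def r_def[symmetric] \<rho>_def[symmetric] by simp
      also have "\<dots> = (\<Sum>i\<le>n. (r i)\<^sup>2) + \<rho>\<^sup>2 + t * (2 * L + t * K)"
        by (simp add: L_def K_def power2_eq_square algebra_simps sum.distrib sum_distrib_left)
      finally have "0 \<le> t * (2 * L + t * K)" by simp
      then show ?thesis using t by (simp add: zero_le_mult_iff)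
    qed
    have "0 \<le> L"
    proof (rule ccontr)
      assume "\<not> 0 \<le> L"
      then have L: "L < 0" by simp
      \<comment> \<open>This step gives \<open>t * K \<le> - L\<close>, hence
        \<open>2 * L + t * K \<le> L < 0\<close>, contradicting \<open>pert\<close>.\<close>
      define t where "t = min 1 (- L / (K + 1))"
      have "0 < t" "t \<le> 1" using L K0 by (auto simp: t_def divide_neg_pos)
      moreover have "t * K \<le> - L"
      proof -
        have "t * K \<le> (- L / (K + 1)) * (K + 1)"
          using K0 L \<open>0 < t\<close> by (intro mult_mono) (auto simp: t_def)
        then show ?thesis using K0 by simp
      qed
      ultimately show False using pert[of t] L by linarith
    qed
    then show ?thesis by (simp add: L_def d_def D_def)
  qed
  have "(\<Sum>i\<le>n. (r i)\<^sup>2) + \<rho>\<^sup>2 \<le> \<eta>" if "0 < \<eta>" for \<eta>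
  proof -
    have "0 \<le> \<rho>" by (simp add: \<rho>_def)
    \<comment> \<open>In the direction \<open>- r\<close> the support bound opposes
      \<open>first_order\<close>; adding the two leaves the squared length of the residual.\<close>
    from support[OF this that, of "\<lambda>i. - r i"] obtain u where u: "u \<in> contracts lo hi"
      "(\<Sum>i\<le>n. - r i * v i) - \<rho> * \<tau> - \<eta> \<le> (\<Sum>i\<le>n. - r i * moment u i) - \<rho> * cost u"
      unfolding cost_def by blast
    have "\<rho> * (cost w - \<tau>) = \<rho>\<^sup>2" by (auto simp: \<rho>_def max_def power2_eq_square)
    moreover have "(\<Sum>i\<le>n. r i * (moment u i - moment w i))
      = (\<Sum>i\<le>n. r i * moment u i) - (\<Sum>i\<le>n. r i * v i) - (\<Sum>i\<le>n. (r i)\<^sup>2)"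
      by (simp add: r_def power2_eq_square sum_subtractf[symmetric] algebra_simps)
    ultimately show ?thesis
      using first_order[OF u(1)] u(2) by (simp add: sum_negf algebra_simps)
  qed
  then have "(\<Sum>i\<le>n. (r i)\<^sup>2) + \<rho>\<^sup>2 \<le> 0" by (rule field_le_epsilon[of _ 0, simplified])
  moreover have "0 \<le> (\<Sum>i\<le>n. (r i)\<^sup>2)" "0 \<le> \<rho>\<^sup>2" by (simp_all add: sum_nonneg)
  ultimately have z: "(\<Sum>i\<le>n. (r i)\<^sup>2) = 0" "\<rho>\<^sup>2 = 0" by linarith+
  have "r i = 0" if "i \<le> n" for i using z(1) that by (simp add: sum_nonneg_eq_0_iff)
  then have "moment w i = v i" if "i \<le> n" for i using that by (simp add: r_def)
  moreover have "cost w \<le> \<tau>" using z(2) by (simp add: \<rho>_def max_def split: if_splits)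
  ultimately show ?thesis using that[OF w] by (simp add: cost_def)
qed

section \<open>Lagrangian values and convex functionals in terms of excesses\<close>

lemma comb_diff: "comb (\<lambda>i. r i - s * e i) x = comb r x - s * comb e x"
  using comb_linear[of 1 r x "- s" e] by simp

text \<open>The support function of the zonoid of moment vectors of contracts with values in \<open>[0, 1]\<close>.\<close>

definition excess :: "(nat \<Rightarrow> real) \<Rightarrow> real" where
  "excess b = (LINT x|M. max 0 (comb b x))"

text \<open>With \<open>payoff_integral_attained\<close> this determines the maximal Lagrangian up
  to \<epsilon>. The experiment enters only through \<open>excess\<close>, since each density has
  integral 1.\<close>

lemma payoff_integral_le:
  assumes grid: "chord_grid lo hi \<phi> \<epsilon> N h \<sigma>" and cont: "continuous_on {lo..hi} \<phi>"
    and w: "w \<in> contracts lo hi" and e: "\<And>i. i \<le> n \<Longrightarrow> 0 \<le> e i"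
  shows "(\<Sum>i\<le>n. r i * moment w i) - (LINT x|M. \<phi> (w x) * comb e x)
    \<le> lo * sum r {..n} - \<phi> lo * sum e {..n} + (\<Sum>j<N. h * excess (\<lambda>i. r i - \<sigma> j * e i)) + \<epsilon> * sum e {..n}"
proof -
  interpret chord_grid lo hi \<phi> \<epsilon> N h \<sigma> by (rule grid)
  note int = integrable_contract[OF w integrable_comb[of r]] integrable_compose_contract[OF w cont integrable_comb[of e]]
  have "(LINT x|M. w x * comb r x - \<phi> (w x) * comb e x)
    \<le> (LINT x|M. lo * comb r x - \<phi> lo * comb e x + (\<Sum>j<N. h * max 0 (comb (\<lambda>i. r i - \<sigma> j * e i) x)) + \<epsilon> * comb e x)"
  proof (rule integral_mono)
    fix x assume "x \<in> space M"
    then show "w x * comb r x - \<phi> (w x) * comb e x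
      \<le> lo * comb r x - \<phi> lo * comb e x + (\<Sum>j<N. h * max 0 (comb (\<lambda>i. r i - \<sigma> j * e i) x)) + \<epsilon> * comb e x"
      using payoff_le_hinges[OF contracts_range[OF w] comb_nonneg[OF e]] by (simp add: comb_diff)
  qed (use int in auto)
  then show ?thesis
    using int by (simp add: integral_contract_comb[OF w] integral_comb excess_def)
qed

lemma payoff_integral_attained:
  assumes grid: "chord_grid lo hi \<phi> \<epsilon> N h \<sigma>" and cont: "continuous_on {lo..hi} \<phi>"
    and e: "\<And>i. i \<le> n \<Longrightarrow> 0 \<le> e i"
  shows "\<exists>w\<in>contracts lo hi. (\<Sum>i\<le>n. r i * moment w i) - (LINT x|M. \<phi> (w x) * comb e x)
    = lo * sum r {..n} - \<phi> lo * sum e {..n} + (\<Sum>j<N. h * excess (\<lambda>i. r i - \<sigma> j * e i))"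
proof -
  interpret chord_grid lo hi \<phi> \<epsilon> N h \<sigma> by (rule grid)
  define w where "w x = threshold (comb r x) (comb e x)" for x
  have "w \<in> borel_measurable M" unfolding w_def threshold_def by measurable
  then have w: "w \<in> contracts lo hi"
    using threshold_attains(1)[OF comb_nonneg[OF e]] by (auto simp: contracts_def w_def)
  note int = integrable_contract[OF w integrable_comb[of r]] integrable_compose_contract[OF w cont integrable_comb[of e]]
  have "(LINT x|M. w x * comb r x - \<phi> (w x) * comb e x)
    = (LINT x|M. lo * comb r x - \<phi> lo * comb e x + (\<Sum>j<N. h * max 0 (comb (\<lambda>i. r i - \<sigma> j * e i) x)))"
    using threshold_attains(2)[OF comb_nonneg[OF e]]
    by (intro Bochner_Integration.integral_cong) (auto simp: w_def comb_diff)
  then show ?thesis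
    using int w by (intro bexI[of _ w]) (simp_all add: integral_contract_comb[OF w] integral_comb excess_def)
qed

text \<open>Here \<open>w\<close> is the ratio of \<open>comb r\<close> to \<open>comb e\<close>;
  the product form imposes nothing on it where both vanish. Multiplying a hinge of \<open>w\<close>
  by \<open>comb e\<close> gives the positive part of a combination of densities.\<close>

lemma hinge_integral:
  assumes w: "w \<in> contracts lo hi" and cont: "continuous_on {lo..hi} \<phi>"
    and e: "\<And>i. i \<le> n \<Longrightarrow> 0 \<le> e i" and r: "\<And>x. x \<in> space M \<Longrightarrow> w x * comb e x = comb r x"
    and approx: "\<And>t. t \<in> {lo..hi} \<Longrightarrow> \<bar>\<phi> t - (\<alpha> + \<beta> * t + (\<Sum>l<K. c l * max 0 (t - k l)))\<bar> \<le> \<epsilon>"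
  shows "\<bar>(LINT x|M. \<phi> (w x) * comb e x)
    - (\<alpha> * sum e {..n} + \<beta> * sum r {..n} + (\<Sum>l<K. c l * excess (\<lambda>i. r i - k l * e i)))\<bar> \<le> \<epsilon> * sum e {..n}"
proof -
  define P where "P x = \<alpha> * comb e x + \<beta> * comb r x + (\<Sum>l<K. c l * max 0 (comb (\<lambda>i. r i - k l * e i) x))" for x
  have P: "integrable M P" unfolding P_def by simp
  have P_int: "integral\<^sup>L M P = \<alpha> * sum e {..n} + \<beta> * sum r {..n} + (\<Sum>l<K. c l * excess (\<lambda>i. r i - k l * e i))"
    unfolding P_def by (simp add: integral_comb excess_def)
  note int = integrable_compose_contract[OF w cont integrable_comb[of e]]
  have close: "\<bar>\<phi> (w x) * comb e x - P x\<bar> \<le> \<epsilon> * comb e x" if x: "x \<in> space M" for x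
  proof -
    have m: "0 \<le> comb e x" using comb_nonneg[OF e x] .
    have "max 0 (w x - k l) * comb e x = max 0 (comb (\<lambda>i. r i - k l * e i) x)" for l
      using r[OF x] m by (simp add: comb_diff max_mult_distrib_right left_diff_distrib)
    then have "P x = (\<alpha> + \<beta> * w x + (\<Sum>l<K. c l * max 0 (w x - k l))) * comb e x"
      by (simp add: P_def r[OF x, symmetric] distrib_right sum_distrib_right mult.assoc)
    then have "\<bar>\<phi> (w x) * comb e x - P x\<bar>
        = \<bar>\<phi> (w x) - (\<alpha> + \<beta> * w x + (\<Sum>l<K. c l * max 0 (w x - k l)))\<bar> * comb e x"
      using m by (simp add: abs_mult flip: left_diff_distrib)
    also have "\<dots> \<le> \<epsilon> * comb e x"
      using approx[OF contracts_range[OF w x]] m by (rule mult_right_mono)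
    finally show ?thesis .
  qed
  have "\<bar>(LINT x|M. \<phi> (w x) * comb e x) - integral\<^sup>L M P\<bar> = \<bar>LINT x|M. \<phi> (w x) * comb e x - P x\<bar>"
    using int P by simp
  also have "\<dots> \<le> (LINT x|M. \<bar>\<phi> (w x) * comb e x - P x\<bar>)" by (rule integral_abs_bound)
  also have "\<dots> \<le> (LINT x|M. \<epsilon> * comb e x)"
    using close int P by (intro integral_mono) auto
  finally show ?thesis unfolding P_int by (simp add: integral_comb)
qed

end

section \<open>Transfer of contracts between families\<close>

locale excess_dominated = F: densities M n f + G: densities M' n g
  for M :: "'a measure" and M' :: "'b measure" and n :: nat
    and f :: "nat \<Rightarrow> 'a \<Rightarrow> real" and g :: "nat \<Rightarrow> 'b \<Rightarrow> real" +
  assumes excess_le: "G.excess b \<le> F.excess b"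
begin

lemma contract_transfer:
  assumes le: "lo \<le> hi" and cont: "continuous_on {lo..hi} \<phi>" and conv: "convex_on {lo..hi} \<phi>"
    and e: "\<And>i. i \<le> n \<Longrightarrow> 0 \<le> e i" and w': "w' \<in> G.contracts lo hi"
  obtains w where "w \<in> F.contracts lo hi" "\<And>i. i \<le> n \<Longrightarrow> F.moment w i = G.moment w' i"
    "(LINT x|M. \<phi> (w x) * F.comb e x) \<le> (LINT y|M'. \<phi> (w' y) * G.comb e y)"
proof (rule F.moments_attained[where e=e, OF le cont conv e, where v="G.moment w'" and \<tau>="LINT y|M'. \<phi> (w' y) * G.comb e y"])
  fix r :: "nat \<Rightarrow> real" and \<rho> \<eta> :: real
  assume \<rho>: "0 \<le> \<rho>" and \<eta>: "0 < \<eta>"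
  have e0: "0 \<le> sum e {..n}" using e by (intro sum_nonneg) auto
  define \<epsilon> where "\<epsilon> = \<eta> / (sum e {..n} + 1)"
  have \<epsilon>: "0 < \<epsilon>" using e0 \<eta> by (simp add: \<epsilon>_def)
  have small: "\<epsilon> * sum e {..n} \<le> \<eta>" using e0 \<eta> by (simp add: \<epsilon>_def field_simps)
  \<comment> \<open>The multiplier \<rho> is absorbed into the cost function, so that
    \<open>\<rho> = 0\<close> needs no separate case.\<close>
  have cont': "continuous_on {lo..hi} (\<lambda>u. \<rho> * \<phi> u)" using cont by (intro continuous_intros)
  have conv': "convex_on {lo..hi} (\<lambda>u. \<rho> * \<phi> u)" using \<rho> conv by (rule convex_on_cmul)
  obtain N h \<sigma> where grid: "chord_grid lo hi (\<lambda>u. \<rho> * \<phi> u) \<epsilon> N h \<sigma>"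
    using chord_grid_exists[OF le conv' cont' \<epsilon>] .
  then have h: "0 \<le> h" by (rule chord_grid.h_nonneg)
  obtain w where w: "w \<in> F.contracts lo hi"
    "(\<Sum>i\<le>n. r i * F.moment w i) - (LINT x|M. \<rho> * \<phi> (w x) * F.comb e x)
    = lo * sum r {..n} - \<rho> * \<phi> lo * sum e {..n} + (\<Sum>j<N. h * F.excess (\<lambda>i. r i - \<sigma> j * e i))"
    using F.payoff_integral_attained[where e=e, OF grid cont' e] by blast
  have "(\<Sum>i\<le>n. r i * G.moment w' i) - (LINT y|M'. \<rho> * \<phi> (w' y) * G.comb e y)
    \<le> lo * sum r {..n} - \<rho> * \<phi> lo * sum e {..n} + (\<Sum>j<N. h * G.excess (\<lambda>i. r i - \<sigma> j * e i)) + \<epsilon> * sum e {..n}"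
    by (rule G.payoff_integral_le[where e=e, OF grid cont' w' e])
  moreover have "(\<Sum>j<N. h * G.excess (\<lambda>i. r i - \<sigma> j * e i)) \<le> (\<Sum>j<N. h * F.excess (\<lambda>i. r i - \<sigma> j * e i))"
    using h excess_le by (intro sum_mono mult_left_mono)
  ultimately have "(\<Sum>i\<le>n. r i * G.moment w' i) - (LINT y|M'. \<rho> * \<phi> (w' y) * G.comb e y) - \<eta>
    \<le> (\<Sum>i\<le>n. r i * F.moment w i) - (LINT x|M. \<rho> * \<phi> (w x) * F.comb e x)"
    using w(2) small by linarith
  then show "\<exists>w\<in>F.contracts lo hi. (\<Sum>i\<le>n. r i * G.moment w' i) - \<rho> * (LINT y|M'. \<phi> (w' y) * G.comb e y) - \<eta>
      \<le> (\<Sum>i\<le>n. r i * F.moment w i) - \<rho> * (LINT x|M. \<phi> (w x) * F.comb e x)"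
    using w(1) by (intro bexI[of _ w]) (simp_all add: mult.assoc)
qed blast+

text \<open>The coefficients \<open>r\<close> and \<open>e\<close> are common to both sides: affine
  parts agree, hinge parts are ordered by \<open>excess_le\<close>, and the approximation error
  occurs twice, whence the 2 in \<epsilon>.\<close>

lemma convex_order:
  assumes le: "lo \<le> hi" and cont: "continuous_on {lo..hi} \<phi>" and conv: "convex_on {lo..hi} \<phi>"
    and e: "\<And>i. i \<le> n \<Longrightarrow> 0 \<le> e i"
    and w: "w \<in> F.contracts lo hi" "\<And>x. x \<in> space M \<Longrightarrow> w x * F.comb e x = F.comb r x"
    and w': "w' \<in> G.contracts lo hi" "\<And>y. y \<in> space M' \<Longrightarrow> w' y * G.comb e y = G.comb r y"
  shows "(LINT y|M'. \<phi> (w' y) * G.comb e y) \<le> (LINT x|M. \<phi> (w x) * F.comb e x)"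
proof (rule field_le_epsilon)
  fix \<eta> :: real assume \<eta>: "0 < \<eta>"
  have e0: "0 \<le> sum e {..n}" using e by (intro sum_nonneg) auto
  define \<epsilon> where "\<epsilon> = \<eta> / (2 * (sum e {..n} + 1))"
  have \<epsilon>: "0 < \<epsilon>" using e0 \<eta> by (simp add: \<epsilon>_def)
  have small: "2 * (\<epsilon> * sum e {..n}) \<le> \<eta>" using e0 \<eta> by (simp add: \<epsilon>_def field_simps)
  obtain N h \<sigma> where "chord_grid lo hi \<phi> \<epsilon> N h \<sigma>"
    using chord_grid_exists[OF le conv cont \<epsilon>] .
  then obtain K :: nat and \<alpha> \<beta> :: real and c k :: "nat \<Rightarrow> real" where c: "\<And>l. l < K \<Longrightarrow> 0 \<le> c l"
    and approx: "\<And>t. t \<in> {lo..hi} \<Longrightarrow> \<bar>\<phi> t - (\<alpha> + \<beta> * t + (\<Sum>l<K. c l * max 0 (t - k l)))\<bar> \<le> \<epsilon>"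
    by (rule chord_grid.hinge_approx) blast
  have "(\<Sum>l<K. c l * G.excess (\<lambda>i. r i - k l * e i)) \<le> (\<Sum>l<K. c l * F.excess (\<lambda>i. r i - k l * e i))"
    using c excess_le by (intro sum_mono mult_left_mono) auto
  then show "(LINT y|M'. \<phi> (w' y) * G.comb e y) \<le> (LINT x|M. \<phi> (w x) * F.comb e x) + \<eta>"
    using F.hinge_integral[where e=e, OF w(1) cont e w(2) approx] G.hinge_integral[where e=e, OF w'(1) cont e w'(2) approx] small
    by linarith
qed

end

section \<open>Experiments\<close>

lemma set_integral_eq_restrict:
  fixes h :: "real \<Rightarrow> real"
  shows "(LINT x:{a..b}|lborel. h x) = integral\<^sup>L (restrict_space lborel {a..b}) h"
  by (simp add: set_lebesgue_integral_def integral_restrict_space)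

lemma densities_experiment:
  assumes "is_experiment n a b f"
  shows "densities (restrict_space lborel {a..b}) n f"
  using assms unfolding is_experiment_def set_integral_eq_restrict
  by unfold_locales (auto simp: space_restrict_space integrable_restrict_space set_integrable_def)

lemma wt_nonneg: "d \<in> hatDelta n \<Longrightarrow> i \<le> n \<Longrightarrow> 0 \<le> wt n d i"
  by (auto simp: wt_def hatDelta_def)

lemma wt_mix: "wt n (\<lambda>i. t * d i + (1 - t) * d' i) i = t * wt n d i + (1 - t) * wt n d' i"
  by (simp add: wt_def sum.distrib sum_subtractf sum_distrib_left algebra_simps)

lemma wt_vertex:
  assumes "k \<le> n"
  obtains d where "d \<in> hatDelta n" "\<And>i. i \<le> n \<Longrightarrow> wt n d i = of_bool (i = k)"
proof
  \<comment> \<open>The weight on action 0 is implicit, so its vertex is the zero function.\<close>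
  let ?d = "\<lambda>i. if i = 0 then 0 else of_bool (i = k) :: real"
  have s: "(\<Sum>i=1..n. ?d i) = (if k = 0 then 0 else 1)"
  proof -
    have "(\<Sum>i=1..n. ?d i) = (\<Sum>i\<in>{1..n}. if i = k then if k = 0 then 0 else 1 else 0)"
      by (intro sum.cong) auto
    then show ?thesis using assms by simp
  qed
  show "?d \<in> hatDelta n" using assms s by (auto simp: hatDelta_def)
  show "wt n ?d i = of_bool (i = k)" if "i \<le> n" for i using s by (auto simp: wt_def)
qed

lemma wt_uniform:
  obtains d where "d \<in> hatDelta n" "\<And>i. i \<le> n \<Longrightarrow> wt n d i = 1 / (real n + 1)"
proof
  let ?d = "\<lambda>i. if 1 \<le> i \<and> i \<le> n then 1 / (real n + 1) else 0"
  have "(\<Sum>i=1..n. ?d i) = (\<Sum>i=1..n. 1 / (real n + 1))" by (intro sum.cong) auto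
  then have s: "(\<Sum>i=1..n. ?d i) = real n / (real n + 1)" by simp
  show "?d \<in> hatDelta n" using s by (auto simp: hatDelta_def field_simps)
  show "wt n ?d i = 1 / (real n + 1)" if "i \<le> n" for i
    unfolding wt_def s using that by (auto simp: field_simps)
qed

section \<open>Payoffs and posteriors of one experiment\<close>

locale experiment_family =
  fixes n :: nat and a b :: real and f :: "nat \<Rightarrow> real \<Rightarrow> real"
  assumes is_experiment: "is_experiment n a b f"

sublocale experiment_family \<subseteq> densities "restrict_space lborel {a..b}" n f
  by (rule densities_experiment[OF is_experiment])

context experiment_family begin

abbreviation "M \<equiv> restrict_space lborel {a..b}"

lemma mixdens_comb: "mixdens n f d x = comb (wt n d) x"
  by (simp add: mixdens_def comb_def atMost_atLeast0)

lemma wages_contracts: "wages a b lo hi = contracts lo hi"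
  unfolding wages_def contracts_def set_borel_measurable_def
  by (simp add: borel_measurable_restrict_space_iff space_restrict_space)

lemma pay_eq: "w \<in> contracts lo hi \<Longrightarrow> pay n a b f w d = (\<Sum>i\<le>n. wt n d i * moment w i)"
  by (simp add: pay_def set_integral_eq_restrict mixdens_comb integral_contract_comb)

text \<open>Where the mixture density is 0 the quotient is 0 by convention, and the numerator
  vanishes too, as one term of a zero sum of nonnegative terms.\<close>

lemma post_mult_mixdens:
  assumes q: "q \<in> hatDelta n" and i: "i \<le> n" and x: "x \<in> space M"
  shows "post n f q i x * mixdens n f q x = wt n q i * f i x"
proof (cases "mixdens n f q x = 0")
  case True
  then have "(\<Sum>i\<le>n. wt n q i * f i x) = 0" by (simp add: mixdens_comb comb_def)
  then have "wt n q i * f i x = 0"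
    using i wt_nonneg[OF q] nonneg_f[OF _ x] by (subst (asm) sum_nonneg_eq_0_iff) auto
  then show ?thesis using True by simp
qed (simp add: post_def)

lemma post_bounds:
  assumes q: "q \<in> hatDelta n" and i: "i \<le> n" and x: "x \<in> space M"
  shows "0 \<le> post n f q i x" "post n f q i x \<le> 1"
proof -
  have nn: "0 \<le> wt n q j * f j x" if "j \<le> n" for j
    using wt_nonneg[OF q that] nonneg_f[OF that x] by simp
  have "wt n q i * f i x \<le> mixdens n f q x"
    unfolding mixdens_comb comb_def using i nn by (intro member_le_sum) auto
  moreover have "0 \<le> mixdens n f q x" using nn[OF i] calculation by linarith
  ultimately show "0 \<le> post n f q i x" "post n f q i x \<le> 1"
    using nn[OF i] unfolding post_def by (auto simp: divide_le_eq_1)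
qed

definition score :: "(nat \<Rightarrow> real) \<Rightarrow> (nat \<Rightarrow> real) \<Rightarrow> real \<Rightarrow> real" where
  "score bb q x = (\<Sum>i=1..n. bb i * post n f q i x)"

lemma score_contract:
  assumes q: "q \<in> hatDelta n"
  shows "score bb q \<in> contracts (- (\<Sum>i=1..n. \<bar>bb i\<bar>)) (\<Sum>i=1..n. \<bar>bb i\<bar>)"
proof -
  define B where "B = (\<Sum>i=1..n. \<bar>bb i\<bar>)"
  have "\<bar>score bb q x\<bar> \<le> B" if x: "x \<in> space M" for x
    unfolding score_def B_def
  proof (rule order_trans[OF sum_abs], rule sum_mono)
    fix i assume "i \<in> {1..n}"
    then show "\<bar>bb i * post n f q i x\<bar> \<le> \<bar>bb i\<bar>"
      using post_bounds[OF q _ x, of i] by (simp add: abs_mult mult_left_le)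
  qed
  moreover have "score bb q \<in> borel_measurable M"
    unfolding score_def post_def mixdens_comb
    by (intro borel_measurable_sum borel_measurable_times borel_measurable_divide measurable_f
        borel_measurable_const measurable_comb) auto
  ultimately show ?thesis by (auto simp: contracts_def abs_le_iff minus_le_iff B_def[simplified, symmetric])
qed

text \<open>Brings the score into the form required by \<open>convex_order\<close>, with
  coefficients that do not depend on the experiment.\<close>

lemma score_mult:
  assumes q: "q \<in> hatDelta n" and x: "x \<in> space M"
  shows "score bb q x * comb (wt n q) x = comb (\<lambda>i. if i = 0 then 0 else bb i * wt n q i) x"
proof -
  have "score bb q x * comb (wt n q) x = (\<Sum>i=1..n. bb i * (post n f q i x * mixdens n f q x))"
    by (simp add: score_def mixdens_comb sum_distrib_right mult.assoc)
  also have "\<dots> = (\<Sum>i=1..n. bb i * wt n q i * f i x)"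
    using post_mult_mixdens[OF q _ x] by (intro sum.cong) auto
  also have "\<dots> = comb (\<lambda>i. if i = 0 then 0 else bb i * wt n q i) x"
    unfolding comb_def by (intro sum.mono_neutral_cong_left) auto
  finally show ?thesis .
qed

text \<open>The uniform prior weights every action positively, so each direction \<open>v\<close> is
  reached; the factor \<open>n + 1\<close> undoes the weights. As action 0 has no posterior in the
  score, \<open>v 0\<close> is subtracted from the other coefficients and returns as the shift of
  the hinge.\<close>

lemma excess_uniform:
  assumes q: "q \<in> hatDelta n" and wt: "\<forall>i\<le>n. wt n q i = 1 / (real n + 1)"
  shows "excess v = (LINT x:{a..b}|lborel. max 0 ((\<Sum>i=1..n. ((real n + 1) * (v i - v 0)) * post n f q i x)
      + (real n + 1) * v 0) * mixdens n f q x)"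
  unfolding excess_def set_integral_eq_restrict
proof (rule Bochner_Integration.integral_cong[OF refl])
  fix x assume x: "x \<in> space M"
  define s where "s = score (\<lambda>i. (real n + 1) * (v i - v 0)) q x"
  have m: "0 \<le> comb (wt n q) x" using comb_nonneg[OF wt_nonneg[OF q] x] .
  have w: "comb (wt n q) x = comb (\<lambda>_. 1 / (real n + 1)) x"
    unfolding comb_def by (intro sum.cong) (auto simp: wt)
  have "s * comb (wt n q) x = comb (\<lambda>i. v i - v 0) x"
    unfolding s_def score_mult[OF q x] unfolding comb_def by (intro sum.cong) (auto simp: wt)
  moreover have "(real n + 1) * v 0 * comb (wt n q) x = comb (\<lambda>_. v 0) x"
    unfolding w by (simp add: comb_def sum_distrib_left)
  ultimately have "(s + (real n + 1) * v 0) * comb (wt n q) x = comb v x"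
    using comb_linear[of 1 "\<lambda>i. v i - v 0" x 1 "\<lambda>_. v 0"] by (simp add: distrib_right)
  then have "max 0 (s + (real n + 1) * v 0) * comb (wt n q) x = max 0 (comb v x)"
    using m by (simp add: max_mult_distrib_right)
  then show "max 0 (comb v x) = max 0 ((\<Sum>i=1..n. ((real n + 1) * (v i - v 0)) * post n f q i x)
      + (real n + 1) * v 0) * mixdens n f q x"
    unfolding s_def score_def mixdens_comb by simp
qed

text \<open>The maximiser is the Neyman-Pearson test: pay 1 exactly where the combination is
  positive.\<close>

lemma excess_attained:
  obtains w where "w \<in> contracts 0 1" "excess v = (\<Sum>i\<le>n. v i * moment w i)"
proof
  let ?w = "\<lambda>x. of_bool (0 < comb v x) :: real"
  have "?w \<in> borel_measurable M" by measurable
  then show w: "?w \<in> contracts 0 1" by (simp add: contracts_def)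
  have "excess v = (LINT x|M. ?w x * comb v x)"
    unfolding excess_def by (intro Bochner_Integration.integral_cong) auto
  then show "excess v = (\<Sum>i\<le>n. v i * moment ?w i)"
    using integral_contract_comb[OF w] by simp
qed

lemma le_excess:
  assumes w: "w \<in> contracts 0 1"
  shows "(\<Sum>i\<le>n. v i * moment w i) \<le> excess v"
proof -
  have "(LINT x|M. w x * comb v x) \<le> (LINT x|M. max 0 (comb v x))"
  proof (rule integral_mono)
    show "w x * comb v x \<le> max 0 (comb v x)" if "x \<in> space M" for x
      using contracts_range[OF w that]
      by (cases "0 \<le> comb v x") (auto simp: max_def mult_left_le_one_le mult_le_0_iff)
  qed (use integrable_contract[OF w integrable_comb] in auto)
  then show ?thesis by (simp add: integral_contract_comb[OF w] excess_def)
qed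

text \<open>The correction term is the same for every experiment, so comparing excesses at
  \<open>v\<close> and at \<open>- v\<close> is equivalent.\<close>

lemma excess_uminus: "excess (\<lambda>i. - v i) = excess v - (\<Sum>i\<le>n. v i)"
proof -
  have "excess (\<lambda>i. - v i) = (LINT x|M. max 0 (comb v x) - comb v x)"
    unfolding excess_def using comb_diff[of "\<lambda>_. 0" 1 v]
    by (intro Bochner_Integration.integral_cong) (auto simp: comb_def)
  then show ?thesis by (simp add: integral_comb excess_def)
qed

end

lemma convex_on_hinge: "convex_on UNIV (\<lambda>t::real. max 0 (t + k))"
proof (rule convex_onI)
  fix t x y :: real assume t: "0 < t" "t < 1"
  have "(1 - t) * x + t * y + k = (1 - t) * (x + k) + t * (y + k)" by (simp add: algebra_simps)
  also have "\<dots> \<le> (1 - t) * max 0 (x + k) + t * max 0 (y + k)"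
    using t by (intro add_mono mult_left_mono) auto
  finally have "(1 - t) * x + t * y + k \<le> (1 - t) * max 0 (x + k) + t * max 0 (y + k)" .
  moreover have "0 \<le> (1 - t) * max 0 (x + k) + t * max 0 (y + k)"
    using t by (intro add_nonneg_nonneg mult_nonneg_nonneg) auto
  ultimately show "max 0 ((1 - t) *\<^sub>R x + t *\<^sub>R y + k) \<le> (1 - t) * max 0 (x + k) + t * max 0 (y + k)"
    by simp
qed simp

section \<open>Implications between the orders\<close>

locale experiment_pair = F: experiment_family n a b f + G: experiment_family n a' b' g
  for n a b f a' b' g
begin

definition excess_order :: bool where
  "excess_order \<longleftrightarrow> (\<forall>v. G.excess v \<le> F.excess v)"

lemma LB_imp_excess:
  assumes "LB_ge n a b f a' b' g"
  shows excess_order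
  unfolding excess_order_def
proof
  fix v :: "nat \<Rightarrow> real"
  obtain q where q: "q \<in> hatDelta n" "\<forall>i\<le>n. wt n q i = 1 / (real n + 1)"
    using wt_uniform[of n] by blast
  note LB = assms[unfolded LB_ge_def, THEN bspec, OF q(1), THEN spec, THEN spec, THEN mp,
      OF convex_on_hinge[of "(real n + 1) * v 0"]]
  from LB[of "\<lambda>i. (real n + 1) * (v i - v 0)"] show "G.excess v \<le> F.excess v"
    unfolding F.excess_uniform[OF q] G.excess_uniform[OF q] .
qed

lemma excess_imp_dominated:
  assumes excess_order
  shows "excess_dominated F.M G.M n f g"
  using assms by unfold_locales (simp add: excess_order_def)

lemma excess_imp_LB:
  assumes excess_order
  shows "LB_ge n a b f a' b' g"
  unfolding LB_ge_def
proof (intro ballI allI impI)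
  fix q bb :: "nat \<Rightarrow> real" and C :: "real \<Rightarrow> real"
  assume q: "q \<in> hatDelta n" and C: "convex_on UNIV C"
  interpret excess_dominated F.M G.M n f g by (rule excess_imp_dominated[OF assms])
  \<comment> \<open>Posteriors lie in \<open>{0..1}\<close>, so \<open>B\<close> bounds both scores
    and only \<open>C\<close> on a compact interval matters.\<close>
  define B where "B = (\<Sum>i=1..n. \<bar>bb i\<bar>)"
  have B: "- B \<le> B" by (simp add: B_def sum_nonneg)
  have "continuous_on {- B..B} C"
    using convex_on_continuous[OF open_UNIV C] by (rule continuous_on_subset) simp
  moreover have "convex_on {- B..B} C" using C by (rule convex_on_subset) auto
  ultimately have "(LINT y|G.M. C (G.score bb q y) * G.comb (wt n q) y)
      \<le> (LINT x|F.M. C (F.score bb q x) * F.comb (wt n q) x)"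
    using F.score_contract[OF q, of bb] G.score_contract[OF q, of bb] F.score_mult[OF q] G.score_mult[OF q]
    by (intro convex_order[where e="wt n q", OF B _ _ wt_nonneg[OF q]]) (auto simp: B_def)
  then show "(LINT y:{a'..b'}|lborel. C (\<Sum>i=1..n. bb i * post n g q i y) * mixdens n g q y)
      \<le> (LINT x:{a..b}|lborel. C (\<Sum>i=1..n. bb i * post n f q i x) * mixdens n f q x)"
    unfolding set_integral_eq_restrict F.mixdens_comb G.mixdens_comb F.score_def G.score_def .
qed

text \<open>Equal moments mean equal payoffs from every mixed action, so (IR) and (IC) carry over
  whatever the cost of effort.\<close>

lemma excess_imp_effective:
  assumes excess_order
  shows "more_effective n a b f a' b' g"
  unfolding more_effective_def impl_cost_def
proof (intro ballI allI impI INF_mono)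
  fix ds lo hi c \<gamma> w'
  assume ds: "ds \<in> hatDelta n" and env: "mh_env n lo hi c \<gamma>"
    and w': "w' \<in> feasible n a' b' g lo hi c ds"
  interpret excess_dominated F.M G.M n f g by (rule excess_imp_dominated[OF assms])
  have w'c: "w' \<in> G.contracts lo hi" using w' by (simp add: feasible_def G.wages_contracts)
  obtain w where w: "w \<in> F.contracts lo hi" "\<And>i. i \<le> n \<Longrightarrow> F.moment w i = G.moment w' i"
    "(LINT x|F.M. \<gamma> (w x) * F.comb (wt n ds) x) \<le> (LINT y|G.M. \<gamma> (w' y) * G.comb (wt n ds) y)"
    using contract_transfer[of lo hi \<gamma> "wt n ds" w'] env wt_nonneg[OF ds] w'c unfolding mh_env_def by blast
  have "pay n a b f w d = pay n a' b' g w' d" for d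
    using w(2) by (simp add: F.pay_eq[OF w(1)] G.pay_eq[OF w'c])
  then have "w \<in> feasible n a b f lo hi c ds"
    using w' w(1) by (simp add: feasible_def F.wages_contracts)
  then show "\<exists>w\<in>feasible n a b f lo hi c ds. ereal (LINT x:{a..b}|lborel. \<gamma> (w x) * mixdens n f ds x)
      \<le> ereal (LINT y:{a'..b'}|lborel. \<gamma> (w' y) * mixdens n g ds y)"
    using w(3) unfolding set_integral_eq_restrict F.mixdens_comb G.mixdens_comb by auto
qed

text \<open>A feasible contract bounds the implementation cost by a real number, whereas the infimum
  over no contract is infinite.\<close>

lemma effective_imp_flexible:
  assumes "more_effective n a b f a' b' g"
  shows "more_flexible n a b f a' b' g"
  unfolding more_flexible_def implementable_def
proof (intro ballI allI impI notI)
  fix ds lo hi c \<gamma>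
  assume ds: "ds \<in> hatDelta n" and env: "mh_env n lo hi c \<gamma>"
    and G: "feasible n a' b' g lo hi c ds \<noteq> {}" and F: "feasible n a b f lo hi c ds = {}"
  obtain w where "w \<in> feasible n a' b' g lo hi c ds" using G by blast
  then have "impl_cost n a' b' g lo hi c \<gamma> ds \<le> ereal (LINT y:{a'..b'}|lborel. \<gamma> (w y) * mixdens n g ds y)"
    unfolding impl_cost_def by (rule INF_lower)
  moreover have "impl_cost n a b f lo hi c \<gamma> ds = \<infinity>"
    unfolding impl_cost_def F by (simp add: top_ereal_def)
  moreover have "impl_cost n a b f lo hi c \<gamma> ds \<le> impl_cost n a' b' g lo hi c \<gamma> ds"
    using assms ds env unfolding more_effective_def by blast
  ultimately show False by simp
qed

text \<open>Charging the agent exactly the payoff that a contract under the second experiment yields makes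
  every action optimal there; implementing an interior action under the first experiment then
  forces all its moments to exceed the given ones by one common constant \<open>k \<ge> 0\<close>.\<close>

lemma flexible_shifts_moments:
  assumes flex: "more_flexible n a b f a' b' g" and w': "w' \<in> G.contracts 0 1"
  obtains w k where "w \<in> F.contracts 0 1" "0 \<le> k" "\<And>i. i \<le> n \<Longrightarrow> F.moment w i = G.moment w' i + k"
proof -
  define c where "c d = (\<Sum>i\<le>n. wt n d i * G.moment w' i)" for d
  have "cost_convex n c"
    unfolding cost_convex_def c_def wt_mix
    by (simp add: sum.distrib sum_subtractf sum_distrib_left algebra_simps)
  then have env: "mh_env n 0 1 c (\<lambda>_. 0)"
    by (simp add: mh_env_def convex_on_const)
  obtain q where q: "q \<in> hatDelta n" "\<And>i. i \<le> n \<Longrightarrow> wt n q i = 1 / (real n + 1)"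
    using wt_uniform[of n] by blast
  have "w' \<in> feasible n a' b' g 0 1 c q"
    using w' by (simp add: feasible_def G.wages_contracts G.pay_eq[OF w'] c_def)
  then have "implementable n a b f 0 1 c q"
    using flex q(1) env unfolding more_flexible_def implementable_def by blast
  then obtain w where w: "w \<in> feasible n a b f 0 1 c q" unfolding implementable_def by blast
  then have wc: "w \<in> F.contracts 0 1" by (simp add: feasible_def F.wages_contracts)
  define x where "x i = F.moment w i - G.moment w' i" for i
  have gain: "pay n a b f w d - c d = (\<Sum>i\<le>n. wt n d i * x i)" for d
    by (simp add: F.pay_eq[OF wc] c_def x_def sum_subtractf algebra_simps)
  define k where "k = (\<Sum>i\<le>n. wt n q i * x i)"
  have k0: "0 \<le> k" and opt: "\<And>d. d \<in> hatDelta n \<Longrightarrow> (\<Sum>i\<le>n. wt n d i * x i) \<le> k"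
    using w unfolding feasible_def k_def gain[symmetric] by auto
  have le: "x j \<le> k" if j: "j \<le> n" for j
  proof -
    obtain d where d: "d \<in> hatDelta n" "\<And>i. i \<le> n \<Longrightarrow> wt n d i = of_bool (i = j)"
      using wt_vertex[OF j] by blast
    have "(\<Sum>i\<le>n. wt n d i * x i) = (\<Sum>i\<le>n. of_bool (i = j) * x i)" by (intro sum.cong) (auto simp: d(2))
    also have "\<dots> = x j" using j Int_absorb1[of "{j}" "{..n}"] by (simp add: sum_of_bool_mult_eq Collect_conv_if)
    finally show ?thesis using opt[OF d(1)] by simp
  qed
  \<comment> \<open>At the uniform action \<open>k\<close> is the average of the \<open>x i\<close>;
    none exceeds it, so all are equal to it.\<close>
  have "k = (\<Sum>i\<le>n. x i) / (real n + 1)"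
    unfolding k_def sum_divide_distrib by (intro sum.cong) (auto simp: q(2))
  then have "(\<Sum>i\<le>n. k - x i) = 0" by (simp add: sum_subtractf field_simps)
  then have "x i = k" if "i \<le> n" for i
    using that le by (subst (asm) sum_nonneg_eq_0_iff) auto
  then show ?thesis using that[OF wc k0] by (simp add: x_def algebra_simps)
qed

text \<open>The shift \<open>k\<close> adds \<open>k\<close> times the coordinate sum of
  \<open>v\<close>, which is nonnegative in the first case; \<open>excess_uminus\<close> reduces the
  other case to it.\<close>

lemma flexible_imp_excess:
  assumes flex: "more_flexible n a b f a' b' g"
  shows excess_order
proof -
  have pos: "G.excess v \<le> F.excess v" if v: "0 \<le> (\<Sum>i\<le>n. v i)" for v
  proof -
    obtain w' where w': "w' \<in> G.contracts 0 1" "G.excess v = (\<Sum>i\<le>n. v i * G.moment w' i)"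
      by (rule G.excess_attained)
    obtain w k where w: "w \<in> F.contracts 0 1" "0 \<le> k" "\<And>i. i \<le> n \<Longrightarrow> F.moment w i = G.moment w' i + k"
      using flexible_shifts_moments[OF flex w'(1)] by blast
    have "(\<Sum>i\<le>n. v i * F.moment w i) = G.excess v + k * (\<Sum>i\<le>n. v i)"
      using w(3) by (simp add: w'(2) distrib_left sum.distrib sum_distrib_left mult.commute)
    then show ?thesis using F.le_excess[OF w(1), of v] mult_nonneg_nonneg[OF w(2) v] by linarith
  qed
  have "G.excess v \<le> F.excess v" for v
  proof (cases "0 \<le> (\<Sum>i\<le>n. v i)")
    case False
    then have "G.excess (\<lambda>i. - v i) \<le> F.excess (\<lambda>i. - v i)" by (intro pos) (simp add: sum_negf)
    then show ?thesis unfolding F.excess_uminus G.excess_uminus by simp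
  qed (rule pos)
  then show ?thesis by (simp add: excess_order_def)
qed

end

theorem theorem2:
  fixes n :: nat and a b a' b' :: real and f g :: "nat \<Rightarrow> real \<Rightarrow> real"
  assumes "is_experiment n a b f" and "is_experiment n a' b' g"
  shows "(LB_ge n a b f a' b' g \<longleftrightarrow> more_flexible n a b f a' b' g)
       \<and> (more_flexible n a b f a' b' g \<longleftrightarrow> more_effective n a b f a' b' g)"
proof -
  interpret experiment_pair n a b f a' b' g
    by unfold_locales (fact assms)+
  show ?thesis
    using LB_imp_excess excess_imp_LB excess_imp_effective effective_imp_flexible flexible_imp_excess
    by blast
qed

end
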